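(* Let $\Delta t>0$, $D>0$, $L>0$, $N\in\mathbb{N}$ and $h=2L/N$. Let $n^m,p^m\in\mathcal{C}_{\rm per}$ satisfy $n^m_{i,j,k}>0$ and $p^m_{i,j,k}>0$ for all $1\le i,j,k\le N$, and $n^m-p^m\in\mathring{\mathcal{C}}_{\rm per}$. Then there exists a unique pair $(n^{m+1},p^{m+1})\in[\mathcal{C}_{\rm per}]^2$, with $n^{m+1}_{i,j,k}>0$ and $p^{m+1}_{i,j,k}>0$ for all $1\le i,j,k\le N$ and $n^{m+1}-p^{m+1}\in\mathring{\mathcal{C}}_{\rm per}$, that solves the numerical scheme $$\frac{n^{m+1}-n^m}{\Delta t}=\nabla_h\cdot\left(\breve{\mathcal M}_n^m\nabla_h\mu_n^{m+1}\right),\qquad \frac{p^{m+1}-p^m}{\Delta t}=\nabla_h\cdot\left(\breve{\mathcal M}_p^m\nabla_h\mu_p^{m+1}\right),$$ $$\mu_n^{m+1}=\ln n^{m+1}+(-\Delta_h)^{-1}(n^{m+1}-p^{m+1}),\qquad \mu_p^{m+1}=\ln p^{m+1}+(-\Delta_h)^{-1}(p^{m+1}-n^{m+1}).$$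
   Context: Grid: $\Omega=(-L,L)^3$, uniform spacing $h=2L/N$. $\mathcal{C}_{\rm per}$ is the space of real cell-centered grid functions $\nu=(\nu_{i,j,k})_{i,j,k\in\mathbb{Z}}$ that are $N$-periodic in each index. The average is $\overline{\nu}=\frac{h^3}{|\Omega|}\sum_{i,j,k=1}^N\nu_{i,j,k}$, and $\mathring{\mathcal{C}}_{\rm per}=\{\nu\in\mathcal{C}_{\rm per}:\overline{\nu}=0\}$. Face-centered functions are periodic functions on the points with one index shifted by $\frac12$. Operators: $D_x\nu_{i+1/2,j,k}=\frac1h(\nu_{i+1,j,k}-\nu_{i,j,k})$, $A_x\nu_{i+1/2,j,k}=\frac12(\nu_{i+1,j,k}+\nu_{i,j,k})$, and for face-centered $f$, $d_xf_{i,j,k}=\frac1h(f_{i+1/2,j,k}-f_{i-1/2,j,k})$; similarly for $y$, $z$. The discrete gradient is $\nabla_h\nu=(D_x\nu,D_y\nu,D_z\nu)$, the discrete divergence is $\nabla_h\cdot\vec f=d_xf^x+d_yf^y+d_zf^z$, and $\Delta_h=\nabla_h\cdot\nabla_h$ (the standard 7-point Laplacian). For a scalar function $\mathcal D$ defined at all face centers, $\nabla_h\cdot(\mathcal D\nabla_h\nu)=d_x(\mathcal D D_x\nu)+d_y(\mathcal D D_y\nu)+d_z(\mathcal D D_z\nu)$. For $f\in\mathring{\mathcal{C}}_{\rm per}$, $(-\Delta_h)^{-1}f$ denotes the unique $\psi\in\mathring{\mathcal{C}}_{\rm per}$ with $-\Delta_h\psi=f$. Mobilities: $\breve{\mathcal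 M}_n^m$ is the face-centered function whose values at $x$-, $y$-, $z$-faces are $A_xn^m$, $A_yn^m$, $A_zn^m$ respectively; $\breve{\mathcal M}_p^m$ is defined in the same way from $D\,p^m$. The logarithms are taken pointwise. *)

theory Defs
  imports "HOL-Analysis.Analysis"
begin

type_synonym grid_fun = "int \<Rightarrow> int \<Rightarrow> int \<Rightarrow> real"

(* A face-centered function, given by its values on the x-, y- and z-faces.  Half-integer
   indices are rounded down: index (i, j, k) of the first component is the face
   (i + 1/2, j, k), of the second (i, j + 1/2, k), and of the third (i, j, k + 1/2). *)
type_synonym face_fun = "grid_fun \<times> grid_fun \<times> grid_fun"

definition mesh_size :: "real \<Rightarrow> nat \<Rightarrow> real" where
  "mesh_size L N = 2 * L / real N"

definition C_per :: "nat \<Rightarrow> grid_fun set" where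
  "C_per N = {\<nu>. \<forall>i j k. \<nu> (i + int N) j k = \<nu> i j k \<and> \<nu> i (j + int N) k = \<nu> i j k
                       \<and> \<nu> i j (k + int N) = \<nu> i j k}"

(* (2 * L) ^ 3 is the volume of the domain (-L, L)^3. *)
definition average :: "real \<Rightarrow> nat \<Rightarrow> grid_fun \<Rightarrow> real" where
  "average L N \<nu> = mesh_size L N ^ 3 / (2 * L) ^ 3 *
     (\<Sum>i = 1..int N. \<Sum>j = 1..int N. \<Sum>k = 1..int N. \<nu> i j k)"

definition C_per0 :: "real \<Rightarrow> nat \<Rightarrow> grid_fun set" where
  "C_per0 L N = {\<nu> \<in> C_per N. average L N \<nu> = 0}"

definition positive_on_cells :: "nat \<Rightarrow> grid_fun \<Rightarrow> bool" where
  "positive_on_cells N \<nu> \<longleftrightarrow>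
     (\<forall>i\<in>{1..int N}. \<forall>j\<in>{1..int N}. \<forall>k\<in>{1..int N}. \<nu> i j k > 0)"

definition Dx :: "real \<Rightarrow> grid_fun \<Rightarrow> grid_fun" where
  "Dx h \<nu> = (\<lambda>i j k. (\<nu> (i + 1) j k - \<nu> i j k) / h)"

definition Dy :: "real \<Rightarrow> grid_fun \<Rightarrow> grid_fun" where
  "Dy h \<nu> = (\<lambda>i j k. (\<nu> i (j + 1) k - \<nu> i j k) / h)"

definition Dz :: "real \<Rightarrow> grid_fun \<Rightarrow> grid_fun" where
  "Dz h \<nu> = (\<lambda>i j k. (\<nu> i j (k + 1) - \<nu> i j k) / h)"

definition Ax :: "grid_fun \<Rightarrow> grid_fun" where
  "Ax \<nu> = (\<lambda>i j k. (\<nu> (i + 1) j k + \<nu> i j k) / 2)"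

definition Ay :: "grid_fun \<Rightarrow> grid_fun" where
  "Ay \<nu> = (\<lambda>i j k. (\<nu> i (j + 1) k + \<nu> i j k) / 2)"

definition Az :: "grid_fun \<Rightarrow> grid_fun" where
  "Az \<nu> = (\<lambda>i j k. (\<nu> i j (k + 1) + \<nu> i j k) / 2)"

(* The faces i + 1/2 and i - 1/2 have indices i and i - 1. *)

definition dx :: "real \<Rightarrow> grid_fun \<Rightarrow> grid_fun" where
  "dx h f = (\<lambda>i j k. (f i j k - f (i - 1) j k) / h)"

definition dy :: "real \<Rightarrow> grid_fun \<Rightarrow> grid_fun" where
  "dy h f = (\<lambda>i j k. (f i j k - f i (j - 1) k) / h)"

definition dz :: "real \<Rightarrow> grid_fun \<Rightarrow> grid_fun" where
  "dz h f = (\<lambda>i j k. (f i j k - f i j (k - 1)) / h)"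

definition grad_h :: "real \<Rightarrow> grid_fun \<Rightarrow> face_fun" where
  "grad_h h \<nu> = (Dx h \<nu>, Dy h \<nu>, Dz h \<nu>)"

definition div_h :: "real \<Rightarrow> face_fun \<Rightarrow> grid_fun" where
  "div_h h = (\<lambda>(fx, fy, fz) i j k. dx h fx i j k + dy h fy i j k + dz h fz i j k)"

definition face_mult :: "face_fun \<Rightarrow> face_fun \<Rightarrow> face_fun" where
  "face_mult = (\<lambda>(ax, ay, az) (bx, by', bz).
     (\<lambda>i j k. ax i j k * bx i j k, \<lambda>i j k. ay i j k * by' i j k, \<lambda>i j k. az i j k * bz i j k))"

definition laplace_h :: "real \<Rightarrow> grid_fun \<Rightarrow> grid_fun" where
  "laplace_h h \<nu> = div_h h (grad_h h \<nu>)"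

definition inv_neg_laplace_h :: "real \<Rightarrow> nat \<Rightarrow> grid_fun \<Rightarrow> grid_fun" where
  "inv_neg_laplace_h L N f =
     (THE \<psi>. \<psi> \<in> C_per0 L N \<and> (\<forall>i j k. - laplace_h (mesh_size L N) \<psi> i j k = f i j k))"

definition face_average :: "grid_fun \<Rightarrow> face_fun" where
  "face_average \<nu> = (Ax \<nu>, Ay \<nu>, Az \<nu>)"

(* ln u + (-Delta_h)^{-1} (u - v): mu_n for (u, v) = (n, p), and mu_p for (u, v) = (p, n). *)
definition potential :: "real \<Rightarrow> nat \<Rightarrow> grid_fun \<Rightarrow> grid_fun \<Rightarrow> grid_fun" where
  "potential L N u v = (\<lambda>i j k. ln (u i j k) +
     inv_neg_laplace_h L N (\<lambda>i j k. u i j k - v i j k) i j k)"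

(* n, p are the data at time step m; n', p' are the unknowns at time step m + 1. *)
definition solves_scheme ::
  "real \<Rightarrow> real \<Rightarrow> real \<Rightarrow> nat \<Rightarrow> grid_fun \<Rightarrow> grid_fun \<Rightarrow> grid_fun \<Rightarrow> grid_fun \<Rightarrow> bool" where
  "solves_scheme \<Delta>t D L N n p n' p' \<longleftrightarrow>
     (let h = mesh_size L N;
          Mn = face_average n;
          Mp = face_average (\<lambda>i j k. D * p i j k);
          \<mu>n = potential L N n' p';
          \<mu>p = potential L N p' n'
      in \<forall>i j k.
           (n' i j k - n i j k) / \<Delta>t = div_h h (face_mult Mn (grad_h h \<mu>n)) i j k \<and>
           (p' i j k - p i j k) / \<Delta>t = div_h h (face_mult Mp (grad_h h \<mu>p)) i j k)"

end

theory Submission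
  imports Defs
begin

text \<open>
  In terms of the chemical potentials \<open>\<mu>\<close>, \<open>\<eta>\<close> of \<open>n'\<close>, \<open>p'\<close> and of the electric potential
  \<open>\<phi> = (-\<Delta>\<^sub>h)\<^sup>-\<^sup>1 (n' - p')\<close> one has \<open>n' = exp (\<mu> - \<phi>)\<close> and \<open>p' = exp (\<eta> + \<phi>)\<close>, so positivity is automatic,
  and the scheme together with the Poisson equation for \<open>\<phi>\<close> is the Euler--Lagrange system of the
  convex functional
  \<open>\<Sum> (exp (\<mu> - \<phi>) - n \<mu>) + \<Sum> (exp (\<eta> + \<phi>) - p \<eta>) + \<Delta>t/2 E\<^sub>n(\<mu>) + \<Delta>t/2 E\<^sub>D\<^sub>p(\<eta>) + 1/2 E\<^sub>1(\<phi>)\<close>,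
  where \<open>E\<^sub>M\<close> is the Dirichlet form with mobility \<open>M\<close>. With \<open>\<phi>\<close> of mean zero the functional is
  coercive: the oscillations are controlled by the Dirichlet forms (Poincare), and the means by
  \<open>V exp t - W t\<close> with \<open>V, W > 0\<close> (Jensen). So a minimiser exists. Uniqueness follows by testing the
  difference of two solutions with itself.
\<close>

section \<open>Periodic grid functions\<close>

lemma periodic_int_shift:
  fixes f :: "int \<Rightarrow> 'a"
  assumes "\<And>i. f (i + c) = f i"
  shows "f (i + m * c) = f i"
proof (induction m rule: int_induct[where k = 0])
  case base
  then show ?case by simp
next
  case (step1 m)
  then show ?case using assms[of "i + m * c"] by (simp add: algebra_simps)
next
  case (step2 m)
  then show ?case using assms[of "i + (m - 1) * c"] by (simp add: algebra_simps)
qed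

lemma C_per_shifts:
  assumes "u \<in> C_per N"
  shows "u (i + int N) j k = u i j k" "u i (j + int N) k = u i j k" "u i j (k + int N) = u i j k"
    "u (i + int N + c) j k = u (i + c) j k" "u i (j + int N + c) k = u i (j + c) k"
    "u i j (k + int N + c) = u i j (k + c)"
    "u (i + int N - c) j k = u (i - c) j k" "u i (j + int N - c) k = u i (j - c) k"
    "u i j (k + int N - c) = u i j (k - c)"
proof -
  have *: "u (i + int N) j k = u i j k" "u i (j + int N) k = u i j k" "u i j (k + int N) = u i j k"
    for i j k using assms by (auto simp: C_per_def)
  show "u (i + int N) j k = u i j k" "u i (j + int N) k = u i j k" "u i j (k + int N) = u i j k"
    by (fact *)+
  show "u (i + int N + c) j k = u (i + c) j k" "u i (j + int N + c) k = u i (j + c) k"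
    "u i j (k + int N + c) = u i j (k + c)"
    using *(1)[of "i + c" j k] *(2)[of i "j + c" k] *(3)[of i j "k + c"] by (simp_all add: ac_simps)
  show "u (i + int N - c) j k = u (i - c) j k" "u i (j + int N - c) k = u i (j - c) k"
    "u i j (k + int N - c) = u i j (k - c)"
    using *(1)[of "i - c" j k] *(2)[of i "j - c" k] *(3)[of i j "k - c"] by (simp_all add: algebra_simps)
qed

lemma C_per_const: "(\<lambda>i j k. c) \<in> C_per N"
  by (simp add: C_per_def)

lemma C_per_map: "u \<in> C_per N \<Longrightarrow> (\<lambda>i j k. g (u i j k)) \<in> C_per N"
  by (simp add: C_per_def)

lemma C_per_map2:
  "u \<in> C_per N \<Longrightarrow> v \<in> C_per N \<Longrightarrow> (\<lambda>i j k. g (u i j k) (v i j k)) \<in> C_per N"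
  by (simp add: C_per_def)

text \<open>The representative cell does not depend on \<open>u\<close>, so several periodic
  functions can be moved to the same cell at once. This reduces statements on the infinite index set
  to the \<open>N ^ 3\<close> cells of one period.\<close>

lemma C_per_representative:
  assumes "N \<ge> 1"
  obtains i' j' k' where "i' \<in> {1..int N}" "j' \<in> {1..int N}" "k' \<in> {1..int N}"
    "\<And>u. u \<in> C_per N \<Longrightarrow> u i j k = u i' j' k'"
proof -
  \<comment> \<open>Reduction modulo \<open>N\<close>; the shift by 1 is there because the residues
    must lie in \<open>{1..int N}\<close> and not in \<open>{0..int N - 1}\<close>.\<close>
  define w where "w i = (i - 1) mod int N + 1" for i
  have w: "w i \<in> {1..int N}" for i
    using assms pos_mod_bound[of "int N" "i - 1"] pos_mod_sign[of "int N" "i - 1"]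
    unfolding w_def atLeastAtMost_iff by linarith
  have *: "i = w i + ((i - 1) div int N) * int N" for i
    using div_mult_mod_eq[of "i - 1" "int N"] unfolding w_def by linarith
  have "u i j k = u (w i) (w j) (w k)" if u: "u \<in> C_per N" for u
  proof -
    have "u i j k = u (w i) j k"
      by (subst *[of i], rule periodic_int_shift) (rule C_per_shifts(1)[OF u])
    also have "\<dots> = u (w i) (w j) k"
      by (subst *[of j], rule periodic_int_shift) (rule C_per_shifts(2)[OF u])
    also have "\<dots> = u (w i) (w j) (w k)"
      by (subst *[of k], rule periodic_int_shift) (rule C_per_shifts(3)[OF u])
    finally show ?thesis .
  qed
  with w show ?thesis by (intro that[of "w i" "w j" "w k"]) auto
qed

lemma C_per_eqI:
  assumes "N \<ge> 1" "u \<in> C_per N" "v \<in> C_per N"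
    "\<And>i j k. i \<in> {1..int N} \<Longrightarrow> j \<in> {1..int N} \<Longrightarrow> k \<in> {1..int N} \<Longrightarrow> u i j k = v i j k"
  shows "u i j k = v i j k"
proof -
  obtain i' j' k' where *: "i' \<in> {1..int N}" "j' \<in> {1..int N}" "k' \<in> {1..int N}"
    "\<And>u. u \<in> C_per N \<Longrightarrow> u i j k = u i' j' k'"
    using C_per_representative[OF assms(1)] by metis
  show ?thesis using assms(4)[OF *(1-3)] *(4)[OF assms(2)] *(4)[OF assms(3)] by simp
qed

text \<open>The minimum over the finitely many cells of one period is positive, and by periodicity
  it bounds all values.\<close>

lemma C_per_positive_bound:
  assumes "N \<ge> 1" "u \<in> C_per N" "positive_on_cells N u"
  obtains m where "m > 0" "\<And>i j k. m \<le> u i j k"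
proof -
  let ?I = "{1..int N}"
  let ?A = "(\<lambda>(i, j, k). u i j k) ` (?I \<times> ?I \<times> ?I)"
  have fin: "finite ?A" by simp
  have ne: "?A \<noteq> {}" using assms(1) by auto
  have "Min ?A > 0"
    using assms(3) by (subst Min_gr_iff[OF fin ne]) (auto simp: positive_on_cells_def)
  moreover have "Min ?A \<le> u i j k" for i j k
  proof -
    obtain i' j' k' where *: "i' \<in> ?I" "j' \<in> ?I" "k' \<in> ?I"
      "\<And>u. u \<in> C_per N \<Longrightarrow> u i j k = u i' j' k'"
      using C_per_representative[OF assms(1)] by metis
    then have "u i j k \<in> ?A" using assms(2) by (auto intro!: image_eqI[where x = "(i', j', k')"])
    then show ?thesis using fin by simp
  qed
  ultimately show ?thesis by (rule that)
qed

section \<open>Sums over one period\<close>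

definition cell_sum :: "nat \<Rightarrow> grid_fun \<Rightarrow> real" where
  "cell_sum N u = (\<Sum>i = 1..int N. \<Sum>j = 1..int N. \<Sum>k = 1..int N. u i j k)"

lemma cell_sum_add: "cell_sum N (\<lambda>i j k. u i j k + v i j k) = cell_sum N u + cell_sum N v"
  by (simp add: cell_sum_def sum.distrib)

lemma cell_sum_diff: "cell_sum N (\<lambda>i j k. u i j k - v i j k) = cell_sum N u - cell_sum N v"
  by (simp add: cell_sum_def sum_subtractf)

lemma cell_sum_minus: "cell_sum N (\<lambda>i j k. - u i j k) = - cell_sum N u"
  by (simp add: cell_sum_def sum_negf)

lemma cell_sum_mult: "cell_sum N (\<lambda>i j k. c * u i j k) = c * cell_sum N u"
  by (simp add: cell_sum_def sum_distrib_left)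

lemma cell_sum_divide: "cell_sum N (\<lambda>i j k. u i j k / c) = cell_sum N u / c"
  by (simp add: cell_sum_def sum_divide_distrib)

lemma cell_sum_const: "cell_sum N (\<lambda>i j k. c) = real N ^ 3 * c"
  by (simp add: cell_sum_def power3_eq_cube)

lemmas cell_sum_linear = cell_sum_add cell_sum_diff cell_sum_minus cell_sum_mult cell_sum_divide
  cell_sum_const

lemma cell_sum_mono: "(\<And>i j k. u i j k \<le> v i j k) \<Longrightarrow> cell_sum N u \<le> cell_sum N v"
  unfolding cell_sum_def by (intro sum_mono)

lemma cell_sum_nonneg: "(\<And>i j k. 0 \<le> u i j k) \<Longrightarrow> 0 \<le> cell_sum N u"
  unfolding cell_sum_def by (intro sum_nonneg)

lemma cell_sum_abs_le:
  assumes "\<And>i j k. \<bar>u i j k\<bar> \<le> v i j k"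
  shows "\<bar>cell_sum N u\<bar> \<le> cell_sum N v"
proof -
  have "cell_sum N u \<le> cell_sum N v" "cell_sum N (\<lambda>i j k. - u i j k) \<le> cell_sum N v"
    using assms by (auto intro!: cell_sum_mono simp: abs_le_iff)
  then show ?thesis by (simp add: cell_sum_minus abs_le_iff)
qed

lemma cell_sum_member:
  assumes "\<And>i j k. 0 \<le> u i j k" "i \<in> {1..int N}" "j \<in> {1..int N}" "k \<in> {1..int N}"
  shows "u i j k \<le> cell_sum N u"
proof -
  have "u i j k \<le> (\<Sum>k = 1..int N. u i j k)"
    using assms by (intro member_le_sum) auto
  also have "\<dots> \<le> (\<Sum>j = 1..int N. \<Sum>k = 1..int N. u i j k)"
    using assms by (intro member_le_sum[of j _ "\<lambda>j. \<Sum>k = 1..int N. u i j k"]) (auto intro!: sum_nonneg)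
  also have "\<dots> \<le> (\<Sum>i = 1..int N. \<Sum>j = 1..int N. \<Sum>k = 1..int N. u i j k)"
    using assms by (intro member_le_sum[of i _ "\<lambda>i. \<Sum>j = 1..int N. \<Sum>k = 1..int N. u i j k"])
      (auto intro!: sum_nonneg)
  finally show ?thesis by (simp add: cell_sum_def)
qed

text \<open>Used to turn a vanishing sum of squares, or of other nonnegative terms, into a pointwise
  equation at every index.\<close>

lemma cell_sum_nonneg_eq_0:
  assumes "N \<ge> 1" "u \<in> C_per N" "\<And>i j k. 0 \<le> u i j k" "cell_sum N u \<le> 0"
  shows "u i j k = 0"
proof (rule C_per_eqI[OF assms(1,2) C_per_const])
  fix i j k assume "i \<in> {1..int N}" "j \<in> {1..int N}" "k \<in> {1..int N}"
  then have "u i j k \<le> cell_sum N u" by (intro cell_sum_member assms)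
  with assms(3)[of i j k] assms(4) show "u i j k = 0" by simp
qed

lemma sum_periodic_shift:
  fixes f :: "int \<Rightarrow> real"
  assumes "\<And>i. f (i + int N) = f i"
  shows "(\<Sum>i = 1..int N. f (i + 1)) = (\<Sum>i = 1..int N. f i)"
proof (cases "N = 0")
  case False
  have "(\<Sum>i = 1..int N. f (i + 1)) = (\<Sum>i = 2..int N + 1. f i)"
    by (rule sum.reindex_bij_witness[where i = "\<lambda>i. i - 1" and j = "\<lambda>i. i + 1"]) auto
  also have "{2..int N + 1} = insert (int N + 1) {2..int N}" using False by auto
  also have "sum f \<dots> = f (1 + int N) + sum f {2..int N}" by (simp add: ac_simps)
  also have "f (1 + int N) = f 1" by (rule assms)
  also have "f 1 + sum f {2..int N} = sum f (insert 1 {2..int N})" by simp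
  also have "insert 1 {2..int N} = {1..int N}" using False by auto
  finally show ?thesis .
qed simp

lemma cell_sum_shift:
  assumes "u \<in> C_per N"
  shows "cell_sum N (\<lambda>i j k. u (i + 1) j k) = cell_sum N u"
    "cell_sum N (\<lambda>i j k. u i (j + 1) k) = cell_sum N u"
    "cell_sum N (\<lambda>i j k. u i j (k + 1)) = cell_sum N u"
  unfolding cell_sum_def
  by (intro sum.cong refl sum_periodic_shift[of "\<lambda>i. \<Sum>j = 1..int N. \<Sum>k = 1..int N. u i j k"]
      sum_periodic_shift[of "\<lambda>j. \<Sum>k = 1..int N. u _ j k"] sum_periodic_shift; simp add: C_per_shifts[OF assms])+

lemma cell_sum_has_derivative:
  assumes "\<And>i j k. ((\<lambda>t. f t i j k) has_real_derivative f' i j k) (at x)"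
  shows "((\<lambda>t. cell_sum N (f t)) has_real_derivative cell_sum N f') (at x)"
  unfolding cell_sum_def by (intro DERIV_sum assms)

section \<open>Discrete elliptic operators\<close>

text \<open>Both mobilities of the scheme are face averages of a cell function, \<open>n\<close> or
  \<open>D * p\<close>, and the constant 1 yields \<open>laplace_h\<close>; one operator thus covers
  all three equations.\<close>

definition weighted_laplace :: "real \<Rightarrow> grid_fun \<Rightarrow> grid_fun \<Rightarrow> grid_fun" where
  "weighted_laplace h M u = div_h h (face_mult (face_average M) (grad_h h u))"

text \<open>The energy form of \<open>weighted_laplace\<close>, without the volume weight
  \<open>h ^ 3\<close>.\<close>

definition dirichlet :: "real \<Rightarrow> nat \<Rightarrow> grid_fun \<Rightarrow> grid_fun \<Rightarrow> grid_fun \<Rightarrow> real" where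
  "dirichlet h N M u v = cell_sum N (\<lambda>i j k. Ax M i j k * (Dx h u i j k * Dx h v i j k)
     + Ay M i j k * (Dy h u i j k * Dy h v i j k) + Az M i j k * (Dz h u i j k * Dz h v i j k))"

lemmas grid_defs = Ax_def Ay_def Az_def Dx_def Dy_def Dz_def dx_def dy_def dz_def

lemma laplace_h_conv_weighted: "laplace_h h u = weighted_laplace h (\<lambda>i j k. 1) u"
  by (simp add: laplace_h_def weighted_laplace_def face_mult_def face_average_def grad_h_def div_h_def
      grid_defs)

lemma weighted_laplace_per:
  assumes "M \<in> C_per N" "u \<in> C_per N"
  shows "weighted_laplace h M u \<in> C_per N"
  unfolding weighted_laplace_def face_mult_def face_average_def grad_h_def div_h_def grid_defs
  by (simp add: C_per_def C_per_shifts[OF assms(1)] C_per_shifts[OF assms(2)])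

lemma weighted_laplace_add_mult:
  "weighted_laplace h M (\<lambda>i j k. u i j k + t * v i j k) i j k =
   weighted_laplace h M u i j k + t * weighted_laplace h M v i j k"
  unfolding weighted_laplace_def face_mult_def face_average_def grad_h_def div_h_def grid_defs
  by (simp add: diff_divide_distrib add_divide_distrib algebra_simps)

lemma summation_by_parts:
  assumes "f \<in> C_per N" "v \<in> C_per N"
  shows "cell_sum N (\<lambda>i j k. dx h f i j k * v i j k) = - cell_sum N (\<lambda>i j k. f i j k * Dx h v i j k)"
    "cell_sum N (\<lambda>i j k. dy h f i j k * v i j k) = - cell_sum N (\<lambda>i j k. f i j k * Dy h v i j k)"
    "cell_sum N (\<lambda>i j k. dz h f i j k * v i j k) = - cell_sum N (\<lambda>i j k. f i j k * Dz h v i j k)"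
proof -
  \<comment> \<open>The face left of a cell has index \<open>i - 1\<close>. Shifting this product by
    one cell gives \<open>f i j k * v (i + 1) j k\<close>, the term in which \<open>v\<close> is
    differenced, and a shift does not change the sum over a period.\<close>
  have "(\<lambda>i j k. f (i - 1) j k * v i j k) \<in> C_per N" "(\<lambda>i j k. f i (j - 1) k * v i j k) \<in> C_per N"
    "(\<lambda>i j k. f i j (k - 1) * v i j k) \<in> C_per N"
    by (simp_all add: C_per_def C_per_shifts[OF assms(1)] C_per_shifts[OF assms(2)])
  note * = cell_sum_shift(1)[OF this(1)] cell_sum_shift(2)[OF this(2)] cell_sum_shift(3)[OF this(3)]
  show "cell_sum N (\<lambda>i j k. dx h f i j k * v i j k) = - cell_sum N (\<lambda>i j k. f i j k * Dx h v i j k)"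
    "cell_sum N (\<lambda>i j k. dy h f i j k * v i j k) = - cell_sum N (\<lambda>i j k. f i j k * Dy h v i j k)"
    "cell_sum N (\<lambda>i j k. dz h f i j k * v i j k) = - cell_sum N (\<lambda>i j k. f i j k * Dz h v i j k)"
    using *
    by (simp_all add: dx_def dy_def dz_def Dx_def Dy_def Dz_def left_diff_distrib right_diff_distrib
        diff_divide_distrib cell_sum_diff cell_sum_divide)
qed

lemma weighted_laplace_by_parts:
  assumes "M \<in> C_per N" "u \<in> C_per N" "v \<in> C_per N"
  shows "cell_sum N (\<lambda>i j k. weighted_laplace h M u i j k * v i j k) = - dirichlet h N M u v"
proof -
  have "(\<lambda>i j k. Ax M i j k * Dx h u i j k) \<in> C_per N" "(\<lambda>i j k. Ay M i j k * Dy h u i j k) \<in> C_per N"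
    "(\<lambda>i j k. Az M i j k * Dz h u i j k) \<in> C_per N"
    by (simp_all add: C_per_def C_per_shifts[OF assms(1)] C_per_shifts[OF assms(2)] grid_defs)
  note * = summation_by_parts(1)[OF this(1) assms(3)] summation_by_parts(2)[OF this(2) assms(3)]
    summation_by_parts(3)[OF this(3) assms(3)]
  show ?thesis
    by (simp add: weighted_laplace_def dirichlet_def face_mult_def face_average_def grad_h_def div_h_def
        distrib_right cell_sum_add * mult.assoc)
qed

text \<open>Conservation of mass: test with the constant 1, whose differences vanish.\<close>

lemma cell_sum_weighted_laplace:
  assumes "M \<in> C_per N" "u \<in> C_per N"
  shows "cell_sum N (weighted_laplace h M u) = 0"
  using weighted_laplace_by_parts[OF assms C_per_const[of 1], of h]
  by (simp add: dirichlet_def Dx_def Dy_def Dz_def cell_sum_const)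

text \<open>Along a line the energy is an explicit polynomial in \<open>t\<close>, from which the
  first variation is read off.\<close>

lemma dirichlet_quadratic:
  "dirichlet h N M (\<lambda>i j k. u i j k + t * v i j k) (\<lambda>i j k. u i j k + t * v i j k) =
   dirichlet h N M u u + 2 * t * dirichlet h N M u v + t\<^sup>2 * dirichlet h N M v v"
proof -
  have D: "Dx h (\<lambda>i j k. u i j k + t * v i j k) i j k = Dx h u i j k + t * Dx h v i j k"
    "Dy h (\<lambda>i j k. u i j k + t * v i j k) i j k = Dy h u i j k + t * Dy h v i j k"
    "Dz h (\<lambda>i j k. u i j k + t * v i j k) i j k = Dz h u i j k + t * Dz h v i j k" for i j k
    by (simp_all add: Dx_def Dy_def Dz_def diff_divide_distrib add_divide_distrib algebra_simps)
  show ?thesis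
    unfolding dirichlet_def cell_sum_mult[symmetric] cell_sum_add[symmetric] D
    by (rule arg_cong[where f = "cell_sum N"], intro ext) (simp add: algebra_simps power2_eq_square)
qed

lemma dirichlet_nonneg:
  assumes "\<And>i j k. 0 \<le> M i j k"
  shows "0 \<le> dirichlet h N M u u"
  using assms by (auto simp: dirichlet_def Ax_def Ay_def Az_def intro!: cell_sum_nonneg add_nonneg_nonneg mult_nonneg_nonneg)

lemma dirichlet_ge:
  assumes "\<And>i j k. m \<le> M i j k"
  shows "m * dirichlet h N (\<lambda>i j k. 1) u u \<le> dirichlet h N M u u"
proof -
  have "m \<le> Ax M i j k" "m \<le> Ay M i j k" "m \<le> Az M i j k" for i j k
    using assms[of i j k] assms[of "i + 1" j k] assms[of i "j + 1" k] assms[of i j "k + 1"]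
    by (auto simp: Ax_def Ay_def Az_def)
  then have "m * dirichlet h N (\<lambda>i j k. 1) u u \<le> cell_sum N (\<lambda>i j k.
     Ax M i j k * (Dx h u i j k * Dx h u i j k)
     + Ay M i j k * (Dy h u i j k * Dy h u i j k) + Az M i j k * (Dz h u i j k * Dz h u i j k))"
    unfolding dirichlet_def cell_sum_mult[symmetric]
    by (intro cell_sum_mono) (auto simp: Ax_def[of "\<lambda>i j k. 1"] Ay_def[of "\<lambda>i j k. 1"] Az_def[of "\<lambda>i j k. 1"]
       distrib_left intro!: add_mono mult_right_mono)
  then show ?thesis by (simp add: dirichlet_def)
qed


section \<open>Minimisation over grid functions\<close>

text \<open>Tychonoff's theorem, as the topology on functions is the product topology. For curried
  grid functions it is applied once per index.\<close>

lemma compact_function_box: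
  fixes K :: "'b :: topological_space set"
  assumes "compact K"
  shows "compact {f :: 'a \<Rightarrow> 'b. \<forall>i. f i \<in> K}"
proof -
  have "compactin (product_topology (\<lambda>i :: 'a. euclidean) UNIV) (PiE UNIV (\<lambda>i. K))"
    using assms by (subst compactin_PiE) simp
  then show ?thesis
    by (simp add: euclidean_product_topology PiE_UNIV_domain Pi_def)
qed

lemma compact_grid_box: "compact {u :: grid_fun. \<forall>i j k. \<bar>u i j k\<bar> \<le> R}"
proof -
  have "compact {u :: grid_fun. \<forall>i. u i \<in> {f. \<forall>j. f j \<in> {g. \<forall>k. g k \<in> {-R..R}}}}"
    by (intro compact_function_box compact_Icc)
  also have "{u :: grid_fun. \<forall>i. u i \<in> {f. \<forall>j. f j \<in> {g. \<forall>k. g k \<in> {-R..R}}}} =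
      {u :: grid_fun. \<forall>i j k. \<bar>u i j k\<bar> \<le> R}"
    by (auto simp: abs_le_iff minus_le_iff)
  finally show ?thesis .
qed

text \<open>The direct method: minimising over the compact set \<open>K \<inter> S\<close> is
  enough, because points of \<open>S\<close> outside \<open>K\<close> have values above
  \<open>F x0\<close>.\<close>

lemma attains_inf_if_sublevel_compact:
  fixes F :: "'a :: topological_space \<Rightarrow> real"
  assumes "compact K" "closed S" "continuous_on UNIV F" "x0 \<in> S"
    and "\<And>x. x \<in> S \<Longrightarrow> F x \<le> F x0 \<Longrightarrow> x \<in> K"
  obtains x where "x \<in> S" "\<And>y. y \<in> S \<Longrightarrow> F x \<le> F y"
proof -
  have "compact (K \<inter> S)" using assms by (intro compact_Int_closed)
  moreover have "x0 \<in> K \<inter> S" using assms by auto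
  moreover have "continuous_on (K \<inter> S) F" using assms(3) continuous_on_subset by blast
  ultimately obtain x where x: "x \<in> K \<inter> S" "\<And>y. y \<in> K \<inter> S \<Longrightarrow> F x \<le> F y"
    using continuous_attains_inf[of "K \<inter> S" F] by blast
  have "F x \<le> F y" if "y \<in> S" for y
    using x(2)[of y] x(2)[of x0] \<open>x0 \<in> K \<inter> S\<close> assms(5)[of y] that by force
  with x(1) show ?thesis by (intro that) auto
qed

lemma DERIV_global_min:
  fixes g :: "real \<Rightarrow> real"
  assumes "(g has_real_derivative D) (at 0)" "\<And>t. g 0 \<le> g t"
  shows "D = 0"
  using DERIV_local_min[OF assms(1), of 1] assms(2) by auto

lemma continuous_on_grid_value:
  fixes f :: "'a :: topological_space \<Rightarrow> grid_fun"
  assumes "continuous_on S f"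
  shows "continuous_on S (\<lambda>x. f x i j k)"
  by (rule assms[THEN continuous_on_product_then_coordinatewise,
        THEN continuous_on_product_then_coordinatewise, THEN continuous_on_product_then_coordinatewise])

lemma continuous_on_value [continuous_intros]: "continuous_on S (\<lambda>u :: grid_fun. u i j k)"
  by (rule continuous_on_grid_value[OF continuous_on_id])

lemma continuous_on_cell_sum [continuous_intros]:
  fixes f :: "'a :: topological_space \<Rightarrow> grid_fun"
  assumes "\<And>i j k. continuous_on S (\<lambda>x. f x i j k)"
  shows "continuous_on S (\<lambda>x. cell_sum N (f x))"
  unfolding cell_sum_def by (intro continuous_on_sum assms)

lemma continuous_on_dirichlet [continuous_intros]:
  fixes f :: "'a :: topological_space \<Rightarrow> grid_fun"
  assumes "continuous_on S f"
  shows "continuous_on S (\<lambda>x. dirichlet h N M (f x) (f x))"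
  unfolding dirichlet_def Dx_def Dy_def Dz_def divide_inverse by (intro continuous_intros continuous_on_grid_value[OF assms])

lemma closed_C_per: "closed (C_per N)"
proof -
  have "C_per N = {u. \<forall>i j k. u (i + int N) j k = u i j k \<and> u i (j + int N) k = u i j k
                       \<and> u i j (k + int N) = u i j k}"
    by (simp add: C_per_def)
  also have "closed \<dots>"
    by (intro closed_Collect_all closed_Collect_conj closed_Collect_eq continuous_intros continuous_on_id)
  finally show ?thesis .
qed

section \<open>Scalar inequalities for coercivity\<close>

lemma abs_diff_le_steps:
  fixes f :: "int \<Rightarrow> real"
  assumes "\<And>i. \<bar>f (i + 1) - f i\<bar> \<le> e" "i \<in> {1..int N}"
  shows "\<bar>f i - f 1\<bar> \<le> real N * e"
proof -
  have "\<bar>f (1 + int m) - f 1\<bar> \<le> real m * e" for m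
  proof (induction m)
    case (Suc m)
    have "1 + int (Suc m) = (1 + int m) + 1" by simp
    then show ?case using Suc assms(1)[of "1 + int m"] by (simp add: algebra_simps abs_le_iff)
  qed simp
  from this[of "nat (i - 1)"] have "\<bar>f i - f 1\<bar> \<le> real (nat (i - 1)) * e"
    using assms(2) by simp
  also have "\<dots> \<le> real N * e"
    using assms(2) order_trans[OF abs_ge_zero assms(1)] by (intro mult_right_mono) auto
  finally show ?thesis .
qed

text \<open>For nonnegative \<open>t\<close>, compare \<open>V * exp t\<close> with its tangent at
  the point \<open>s\<close> of slope \<open>2 * W\<close>; subtracting \<open>W * t\<close> leaves
  slope \<open>W\<close>. For negative \<open>t\<close> the linear term already equals
  \<open>W * \<bar>t\<bar>\<close>.\<close>

lemma exp_minus_linear_ge: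
  fixes V W :: real
  assumes "V > 0" "W > 0"
  obtains K where "K \<ge> 0" "\<And>t. W * \<bar>t\<bar> - K \<le> V * exp t - W * t"
proof
  define s where "s = ln (2 * W / V)"
  have s: "V * exp s = 2 * W" using assms by (simp add: s_def)
  show "0 \<le> 2 * W * \<bar>1 - s\<bar>" using assms by simp
  show "W * \<bar>t\<bar> - 2 * W * \<bar>1 - s\<bar> \<le> V * exp t - W * t" for t
  proof (cases "t \<ge> 0")
    case True
    have "2 * W * (1 + (t - s)) = V * (exp s * (1 + (t - s)))" using s by simp
    also have "\<dots> \<le> V * (exp s * exp (t - s))"
      using assms exp_ge_add_one_self[of "t - s"] by (intro mult_left_mono) auto
    also have "\<dots> = V * exp t" by (simp flip: exp_add)
    finally have "2 * W * t + 2 * W * (1 - s) \<le> V * exp t" by (simp add: algebra_simps)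
    moreover have "2 * W * (- \<bar>1 - s\<bar>) \<le> 2 * W * (1 - s)"
      using assms by (intro mult_left_mono) auto
    ultimately show ?thesis using True by (simp add: algebra_simps)
  next
    case False
    have "0 \<le> V * exp t" "0 \<le> 2 * W * \<bar>1 - s\<bar>" using assms by simp_all
    then show ?thesis using False by (simp add: algebra_simps)
  qed
qed

lemma quadratic_ge_linear:
  fixes a b x :: real
  assumes "a > 0"
  shows "x - (b + 1)\<^sup>2 / (4 * a) \<le> a * x\<^sup>2 - b * x"
proof -
  have "0 \<le> a * (x - (b + 1) / (2 * a))\<^sup>2" using assms by simp
  also have "\<dots> = a * x\<^sup>2 - (b + 1) * x + (b + 1)\<^sup>2 / (4 * a)"
    using assms by (simp add: field_simps power2_eq_square)
  finally show ?thesis by (simp add: algebra_simps)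
qed

lemma exp_diff_mult_nonneg: "0 \<le> (exp x - exp y) * (x - y :: real)"
  by (cases "x \<le> y") (auto intro: mult_nonneg_nonneg mult_nonpos_nonpos)

section \<open>Mean-zero functions and the discrete Poincare inequality\<close>

locale periodic_grid =
  fixes L :: real and N :: nat
  assumes L_pos: "L > 0" and N_pos: "N \<ge> 1"
begin

abbreviation "h \<equiv> mesh_size L N"

abbreviation "one \<equiv> (\<lambda>i j k. 1) :: grid_fun"

definition mean :: "grid_fun \<Rightarrow> real" where
  "mean u = cell_sum N u / real N ^ 3"

definition H1 :: "grid_fun \<Rightarrow> real" where
  "H1 u = sqrt (dirichlet h N one u u)"

lemma h_pos: "h > 0"
  using L_pos N_pos by (simp add: mesh_size_def)

lemma H1_nonneg: "H1 u \<ge> 0"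
  by (simp add: H1_def dirichlet_nonneg)

lemma H1_power2: "(H1 u)\<^sup>2 = dirichlet h N one u u"
  by (simp add: H1_def dirichlet_nonneg)

lemma cell_sum_conv_mean: "cell_sum N u = real N ^ 3 * mean u"
  using N_pos by (simp add: mean_def)

lemma C_per0_iff: "u \<in> C_per0 L N \<longleftrightarrow> u \<in> C_per N \<and> cell_sum N u = 0"
  using h_pos L_pos by (simp add: C_per0_def average_def cell_sum_def)

lemma C_per0_per: "u \<in> C_per0 L N \<Longrightarrow> u \<in> C_per N"
  by (simp add: C_per0_iff)

lemma C_per0_minus: "u \<in> C_per0 L N \<Longrightarrow> (\<lambda>i j k. - u i j k) \<in> C_per0 L N"
  by (simp add: C_per0_iff cell_sum_minus C_per_map)

lemma C_per0_add_mult: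
  "u \<in> C_per0 L N \<Longrightarrow> v \<in> C_per0 L N \<Longrightarrow> (\<lambda>i j k. u i j k + t * v i j k) \<in> C_per0 L N"
  by (simp add: C_per0_iff cell_sum_linear C_per_map2[where g = "\<lambda>x y. x + t * y"])

lemma C_per_add_mult:
  "u \<in> C_per N \<Longrightarrow> v \<in> C_per N \<Longrightarrow> (\<lambda>i j k. u i j k + t * v i j k) \<in> C_per N"
  by (rule C_per_map2)

lemma closed_C_per0: "closed (C_per0 L N)"
proof -
  have "C_per0 L N = C_per N \<inter> {u. cell_sum N u = 0}" by (auto simp: C_per0_iff)
  also have "closed \<dots>"
    by (intro closed_Int closed_C_per closed_Collect_eq continuous_intros continuous_on_id)
  finally show ?thesis .
qed

text \<open>The square of a single difference quotient is one of the nonnegative terms whose sum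
  over a period is \<open>(H1 u)\<^sup>2\<close>.\<close>

lemma face_difference_le:
  assumes u: "u \<in> C_per N"
  shows "\<bar>u (i + 1) j k - u i j k\<bar> \<le> h * H1 u" "\<bar>u i (j + 1) k - u i j k\<bar> \<le> h * H1 u"
    "\<bar>u i j (k + 1) - u i j k\<bar> \<le> h * H1 u"
proof -
  define g where "g = (\<lambda>i j k. (Dx h u i j k)\<^sup>2 + (Dy h u i j k)\<^sup>2 + (Dz h u i j k)\<^sup>2)"
  have g: "g \<in> C_per N"
    unfolding g_def Dx_def Dy_def Dz_def by (simp add: C_per_def C_per_shifts[OF u])
  obtain i' j' k' where *: "i' \<in> {1..int N}" "j' \<in> {1..int N}" "k' \<in> {1..int N}"
    "\<And>u. u \<in> C_per N \<Longrightarrow> u i j k = u i' j' k'"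
    using C_per_representative[OF N_pos] by metis
  have "g i j k = g i' j' k'" using *(4)[OF g] .
  also have "\<dots> \<le> cell_sum N g" by (intro cell_sum_member *) (auto simp: g_def)
  also have "\<dots> = (H1 u)\<^sup>2"
    unfolding H1_power2 by (simp add: g_def dirichlet_def Ax_def Ay_def Az_def power2_eq_square)
  finally have le: "g i j k \<le> (H1 u)\<^sup>2" .
  have "(Dx h u i j k)\<^sup>2 \<le> g i j k" "(Dy h u i j k)\<^sup>2 \<le> g i j k" "(Dz h u i j k)\<^sup>2 \<le> g i j k"
    by (auto simp: g_def)
  from this[THEN order_trans[OF _ le]]
  have "\<bar>Dx h u i j k\<bar> \<le> H1 u" "\<bar>Dy h u i j k\<bar> \<le> H1 u" "\<bar>Dz h u i j k\<bar> \<le> H1 u"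
    using H1_nonneg by (auto simp: abs_le_square_iff[symmetric])
  then show "\<bar>u (i + 1) j k - u i j k\<bar> \<le> h * H1 u" "\<bar>u i (j + 1) k - u i j k\<bar> \<le> h * H1 u"
    "\<bar>u i j (k + 1) - u i j k\<bar> \<le> h * H1 u"
    using h_pos by (simp_all add: Dx_def Dy_def Dz_def field_simps)
qed

text \<open>A walk from any cell to the corner cell \<open>(1, 1, 1)\<close> runs along three axes,
  with at most \<open>N\<close> steps of size \<open>h * H1 u\<close> on each. The mean is as close
  to the corner value as the cells are, which doubles the factor 3.\<close>

definition poincare_const :: real where "poincare_const = 6 * real N * h"

lemma poincare_const_nonneg: "poincare_const \<ge> 0"
  using h_pos by (simp add: poincare_const_def)

lemma poincare:
  assumes u: "u \<in> C_per N"
  shows "\<bar>u i j k - mean u\<bar> \<le> poincare_const * H1 u"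
proof -
  define e where "e = real N * (h * H1 u)"
  have cells: "\<bar>u i j k - u 1 1 1\<bar> \<le> 3 * e"
    if "i \<in> {1..int N}" "j \<in> {1..int N}" "k \<in> {1..int N}" for i j k
    using abs_diff_le_steps[of "\<lambda>i. u i j k", OF face_difference_le(1)[OF u] that(1)]
      abs_diff_le_steps[of "\<lambda>j. u 1 j k", OF face_difference_le(2)[OF u] that(2)]
      abs_diff_le_steps[of "\<lambda>k. u 1 1 k", OF face_difference_le(3)[OF u] that(3)]
    unfolding e_def by linarith
  have all: "\<bar>u i j k - u 1 1 1\<bar> \<le> 3 * e" for i j k
  proof -
    obtain i' j' k' where *: "i' \<in> {1..int N}" "j' \<in> {1..int N}" "k' \<in> {1..int N}"
      "\<And>u. u \<in> C_per N \<Longrightarrow> u i j k = u i' j' k'"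
      using C_per_representative[OF N_pos] by metis
    show ?thesis using cells[OF *(1-3)] *(4)[OF u] by simp
  qed
  have "\<bar>cell_sum N (\<lambda>i j k. u i j k - u 1 1 1)\<bar> \<le> cell_sum N (\<lambda>i j k. 3 * e)"
    by (rule cell_sum_abs_le) (rule all)
  then have "\<bar>real N ^ 3 * (mean u - u 1 1 1)\<bar> \<le> real N ^ 3 * (3 * e)"
    by (simp add: cell_sum_diff cell_sum_const cell_sum_conv_mean right_diff_distrib)
  then have "\<bar>mean u - u 1 1 1\<bar> \<le> 3 * e" using N_pos by (simp add: abs_mult)
  with all[of i j k] show ?thesis by (simp add: poincare_const_def e_def)
qed

lemma abs_le_mean_H1:
  "u \<in> C_per N \<Longrightarrow> \<bar>u i j k\<bar> \<le> \<bar>mean u\<bar> + poincare_const * H1 u"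
  using poincare[of u i j k] by linarith

section \<open>The discrete Poisson equation\<close>

lemma poisson_unique:
  assumes "u \<in> C_per0 L N" "v \<in> C_per0 L N" "\<And>i j k. laplace_h h u i j k = laplace_h h v i j k"
  shows "u = v"
proof -
  define w where "w = (\<lambda>i j k. u i j k + (-1) * v i j k)"
  have w: "w \<in> C_per0 L N" unfolding w_def by (intro C_per0_add_mult assms)
  have "weighted_laplace h one w i j k = laplace_h h u i j k + (-1) * laplace_h h v i j k" for i j k
    unfolding w_def laplace_h_conv_weighted by (rule weighted_laplace_add_mult)
  then have "weighted_laplace h one w i j k = 0" for i j k
    using assms(3) by simp
  \<comment> \<open>Testing the equation for \<open>w\<close> with \<open>w\<close> itself. Zero
    energy and zero mean then force \<open>w = 0\<close> by the Poincare inequality.\<close>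
  then have "dirichlet h N one w w = 0"
    using weighted_laplace_by_parts[OF C_per_const[of 1] C_per0_per[OF w] C_per0_per[OF w], of h]
    by (simp add: cell_sum_const)
  moreover have "mean w = 0" using w by (simp add: C_per0_iff mean_def)
  ultimately have "w i j k = 0" for i j k
    using poincare[OF C_per0_per[OF w], of i j k] by (simp add: H1_def)
  then show ?thesis by (simp add: w_def fun_eq_iff)
qed

lemma poisson_solvable:
  assumes f: "f \<in> C_per0 L N"
  obtains \<psi> where "\<psi> \<in> C_per0 L N" "\<And>i j k. - laplace_h h \<psi> i j k = f i j k"
proof -
  \<comment> \<open>Dirichlet's principle: a minimiser of \<open>F\<close> over the mean-zero
    functions solves the equation.\<close>
  define F where "F = (\<lambda>\<phi>. dirichlet h N one \<phi> \<phi> / 2 - cell_sum N (\<lambda>i j k. f i j k * \<phi> i j k))"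
  define W where "W = cell_sum N (\<lambda>i j k. \<bar>f i j k\<bar>)"
  \<comment> \<open>If \<open>F \<psi>\<close> is at most \<open>F ?z = 0\<close>, then
    \<open>(H1 \<psi>)\<^sup>2\<close> is at most
    \<open>2 * (W * poincare_const) * H1 \<psi>\<close>. Cancelling \<open>H1 \<psi>\<close> and
    applying the Poincare inequality once more bounds all values by \<open>R\<close>.\<close>
  define R where "R = poincare_const * (2 * (W * poincare_const))"
  let ?z = "(\<lambda>i j k. 0) :: grid_fun"
  have F0: "F ?z = 0" by (simp add: F_def dirichlet_def cell_sum_const Dx_def Dy_def Dz_def)
  obtain \<phi> where \<phi>: "\<phi> \<in> C_per0 L N" and min: "\<And>\<psi>. \<psi> \<in> C_per0 L N \<Longrightarrow> F \<phi> \<le> F \<psi>"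
  proof (rule attains_inf_if_sublevel_compact[OF compact_grid_box[of R] closed_C_per0,
        where F = F and ?x0.0 = ?z])
    show "continuous_on UNIV F"
      unfolding F_def divide_inverse by (intro continuous_intros continuous_on_id)
    show "?z \<in> C_per0 L N" by (simp add: C_per0_iff C_per_const cell_sum_const)
    fix \<psi> assume \<psi>: "\<psi> \<in> C_per0 L N" "F \<psi> \<le> F ?z"
    have mean: "mean \<psi> = 0" using \<psi> by (simp add: C_per0_iff mean_def)
    have bd: "\<bar>\<psi> i j k\<bar> \<le> poincare_const * H1 \<psi>" for i j k
      using poincare[OF C_per0_per[OF \<psi>(1)]] mean by simp
    have "cell_sum N (\<lambda>i j k. f i j k * \<psi> i j k) \<le>
        cell_sum N (\<lambda>i j k. poincare_const * H1 \<psi> * \<bar>f i j k\<bar>)"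
    proof (rule cell_sum_mono)
      fix i j k
      have "f i j k * \<psi> i j k \<le> \<bar>f i j k\<bar> * \<bar>\<psi> i j k\<bar>" by (metis abs_ge_self abs_mult)
      also have "\<dots> \<le> \<bar>f i j k\<bar> * (poincare_const * H1 \<psi>)" by (intro mult_left_mono bd) simp
      finally show "f i j k * \<psi> i j k \<le> poincare_const * H1 \<psi> * \<bar>f i j k\<bar>" by (simp add: mult_ac)
    qed
    then have "(H1 \<psi>)\<^sup>2 \<le> 2 * (W * poincare_const) * H1 \<psi>"
      using \<psi>(2) F0 by (simp add: F_def H1_power2 cell_sum_mult W_def mult_ac)
    moreover have "0 \<le> W" by (auto simp: W_def intro!: cell_sum_nonneg)
    ultimately have "H1 \<psi> \<le> 2 * (W * poincare_const)"
      using H1_nonneg[of \<psi>] poincare_const_nonneg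
      by (cases "H1 \<psi> = 0") (auto simp: power2_eq_square)
    then have "poincare_const * H1 \<psi> \<le> R"
      unfolding R_def using poincare_const_nonneg by (rule mult_left_mono)
    with bd show "\<psi> \<in> {u. \<forall>i j k. \<bar>u i j k\<bar> \<le> R}" using order_trans by blast
  qed auto
  \<comment> \<open>The residual of the equation. Both summands have mean zero, so \<open>g\<close>
    is an admissible direction, and the first variation along it equals minus the sum of the squares
    of \<open>g\<close>.\<close>
  define g where "g = (\<lambda>i j k. weighted_laplace h one \<phi> i j k + 1 * f i j k)"
  have lap: "weighted_laplace h one \<phi> \<in> C_per0 L N"
    using \<phi> by (simp add: C_per0_iff weighted_laplace_per C_per_const cell_sum_weighted_laplace)
  have g: "g \<in> C_per0 L N" unfolding g_def by (intro C_per0_add_mult lap f)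
  let ?s = "cell_sum N (\<lambda>i j k. f i j k * g i j k)"
  have "F (\<lambda>i j k. \<phi> i j k + t * g i j k) =
      F \<phi> + t * (dirichlet h N one \<phi> g - ?s) + t\<^sup>2 * (dirichlet h N one g g / 2)" for t
  proof -
    have "cell_sum N (\<lambda>i j k. f i j k * (\<phi> i j k + t * g i j k)) =
        cell_sum N (\<lambda>i j k. f i j k * \<phi> i j k) + t * ?s"
      unfolding cell_sum_mult[symmetric] cell_sum_add[symmetric] by (simp add: algebra_simps)
    then show ?thesis unfolding F_def dirichlet_quadratic by (simp add: algebra_simps add_divide_distrib)
  qed
  moreover have "((\<lambda>t. F \<phi> + t * (dirichlet h N one \<phi> g - ?s) + t\<^sup>2 * (dirichlet h N one g g / 2))
      has_real_derivative dirichlet h N one \<phi> g - ?s) (at 0)"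
    by (auto intro!: derivative_eq_intros)
  ultimately have "((\<lambda>t. F (\<lambda>i j k. \<phi> i j k + t * g i j k)) has_real_derivative
      dirichlet h N one \<phi> g - ?s) (at 0)"
    by simp
  from DERIV_global_min[OF this]
  have "dirichlet h N one \<phi> g - ?s = 0"
    using min[OF C_per0_add_mult[OF \<phi> g]] by simp
  then have "cell_sum N (\<lambda>i j k. (g i j k)\<^sup>2) = 0"
    using weighted_laplace_by_parts[OF C_per_const[of 1] C_per0_per[OF \<phi>] C_per0_per[OF g], of h]
    by (simp add: g_def power2_eq_square distrib_right cell_sum_add)
  then have "(g i j k)\<^sup>2 = 0" for i j k
    by (intro cell_sum_nonneg_eq_0[OF N_pos] C_per_map[OF C_per0_per[OF g], of power2]) simp_all
  then have "- laplace_h h \<phi> i j k = f i j k" for i j k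
    by (simp add: g_def laplace_h_conv_weighted minus_equation_iff add_eq_0_iff)
  with \<phi> show ?thesis by (rule that)
qed

lemma inv_neg_laplace_h_eqI:
  assumes "\<psi> \<in> C_per0 L N" "\<And>i j k. - laplace_h h \<psi> i j k = f i j k"
  shows "inv_neg_laplace_h L N f = \<psi>"
  unfolding inv_neg_laplace_h_def
proof (rule the_equality)
  show "\<psi> \<in> C_per0 L N \<and> (\<forall>i j k. - laplace_h h \<psi> i j k = f i j k)" using assms by simp
next
  fix \<psi>' assume *: "\<psi>' \<in> C_per0 L N \<and> (\<forall>i j k. - laplace_h h \<psi>' i j k = f i j k)"
  show "\<psi>' = \<psi>"
  proof (rule poisson_unique)
    have "- laplace_h h \<psi>' i j k = - laplace_h h \<psi> i j k" for i j k
      using assms(2)[of i j k] * by simp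
    then show "laplace_h h \<psi>' i j k = laplace_h h \<psi> i j k" for i j k by simp
  qed (use assms * in auto)
qed

lemma laplace_h_minus: "laplace_h h (\<lambda>i j k. - u i j k) i j k = - laplace_h h u i j k"
  by (simp add: laplace_h_def div_h_def grad_h_def grid_defs diff_divide_distrib)

lemma inv_neg_laplace_h_solves:
  assumes "f \<in> C_per0 L N"
  shows "inv_neg_laplace_h L N f \<in> C_per0 L N" "- laplace_h h (inv_neg_laplace_h L N f) i j k = f i j k"
proof -
  obtain \<psi> where \<psi>: "\<psi> \<in> C_per0 L N" "\<And>i j k. - laplace_h h \<psi> i j k = f i j k"
    using poisson_solvable[OF assms] by blast
  moreover from this have "inv_neg_laplace_h L N f = \<psi>" by (rule inv_neg_laplace_h_eqI)
  ultimately show "inv_neg_laplace_h L N f \<in> C_per0 L N"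
    "- laplace_h h (inv_neg_laplace_h L N f) i j k = f i j k" by simp_all
qed

text \<open>The two species see the inverse Laplacian of \<open>n' - p'\<close> and of its negative;
  by this oddness a single \<phi> with opposite signs serves both.\<close>

lemma inv_neg_laplace_h_minus:
  assumes "f \<in> C_per0 L N"
  shows "inv_neg_laplace_h L N (\<lambda>i j k. - f i j k) = (\<lambda>i j k. - inv_neg_laplace_h L N f i j k)"
  using inv_neg_laplace_h_solves(2)[OF assms]
  by (intro inv_neg_laplace_h_eqI C_per0_minus inv_neg_laplace_h_solves(1) assms)
    (simp add: laplace_h_minus)

section \<open>Coercivity of the energy of one species\<close>

lemma cell_sum_exp_ge:
  assumes "\<mu> \<in> C_per N" "\<phi> \<in> C_per0 L N"
  shows "real N ^ 3 * exp (mean \<mu>) \<le> cell_sum N (\<lambda>i j k. exp (\<mu> i j k - \<phi> i j k))"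
proof -
  \<comment> \<open>Jensen's inequality through the tangent of \<open>exp\<close> at the mean
    \<open>t\<close>. Since \<phi> has mean zero, the linear part sums to zero and the bound is free
    of \<phi>.\<close>
  define t where "t = mean \<mu>"
  have "cell_sum N (\<lambda>i j k. exp t * (1 + ((\<mu> i j k - \<phi> i j k) - t))) \<le>
      cell_sum N (\<lambda>i j k. exp (\<mu> i j k - \<phi> i j k))"
  proof (rule cell_sum_mono)
    fix i j k
    have "exp t * (1 + ((\<mu> i j k - \<phi> i j k) - t)) \<le> exp t * exp ((\<mu> i j k - \<phi> i j k) - t)"
      by (intro mult_left_mono exp_ge_add_one_self) simp
    then show "exp t * (1 + ((\<mu> i j k - \<phi> i j k) - t)) \<le> exp (\<mu> i j k - \<phi> i j k)"
      by (simp flip: exp_add)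
  qed
  moreover have "cell_sum N (\<lambda>i j k. exp t * (1 + ((\<mu> i j k - \<phi> i j k) - t))) = real N ^ 3 * exp t"
    using assms(2)
    unfolding cell_sum_mult cell_sum_add cell_sum_diff cell_sum_const
    by (simp add: C_per0_iff cell_sum_conv_mean[of \<mu>] t_def)
  ultimately show ?thesis by (simp add: t_def)
qed

text \<open>After the Poincare inequality the linear term costs at most
  \<open>W * mean \<mu> + b * H1 \<mu>\<close>. The exponential sum absorbs the first part and the
  Dirichlet form the second. The constants are uniform in \<phi>, so the estimate also applies with
  its negative; \<open>M\<close> is separate from \<open>n\<close> because the second species pairs
  \<open>p\<close> with \<open>D * p\<close>.\<close>

lemma species_energy_coercive:
  assumes n: "n \<in> C_per N" "positive_on_cells N n" and M: "M \<in> C_per N" "positive_on_cells N M"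
    and \<tau>: "\<tau> > 0"
  obtains c K where "c > 0" "K \<ge> 0"
    "\<And>\<mu> \<phi>. \<mu> \<in> C_per N \<Longrightarrow> \<phi> \<in> C_per0 L N \<Longrightarrow> c * \<bar>mean \<mu>\<bar> + H1 \<mu> - K \<le>
       cell_sum N (\<lambda>i j k. exp (\<mu> i j k - \<phi> i j k)) - cell_sum N (\<lambda>i j k. n i j k * \<mu> i j k)
       + \<tau> / 2 * dirichlet h N M \<mu> \<mu>"
proof -
  obtain n0 where n0: "n0 > 0" "\<And>i j k. n0 \<le> n i j k"
    using C_per_positive_bound[OF N_pos n] by blast
  obtain m where m: "m > 0" "\<And>i j k. m \<le> M i j k"
    using C_per_positive_bound[OF N_pos M] by blast
  define V where "V = real N ^ 3"
  define W where "W = cell_sum N n"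
  have V: "V > 0" using N_pos by (simp add: V_def)
  have "V * n0 \<le> W"
    using cell_sum_mono[of "\<lambda>i j k. n0" n N] n0(2) by (simp add: cell_sum_const V_def W_def)
  then have W: "W > 0" using V n0(1) by (meson less_le_trans mult_pos_pos)
  obtain K1 where K1: "K1 \<ge> 0" "\<And>t. W * \<bar>t\<bar> - K1 \<le> V * exp t - W * t"
    using exp_minus_linear_ge[OF V W] by blast
  define a where "a = \<tau> * m / 2"
  define b where "b = W * poincare_const"
  \<comment> \<open>With \<open>m\<close> a lower bound of the mobility,
    \<open>a * (H1 \<mu>)\<^sup>2\<close> bounds the Dirichlet term from below; \<open>K\<close>
    adds up the losses in the two scalar inequalities.\<close>
  have a: "a > 0" using \<tau> m by (simp add: a_def)
  define K where "K = K1 + (b + 1)\<^sup>2 / (4 * a)"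
  show ?thesis
  proof
    show "W > 0" by (fact W)
    show "K \<ge> 0" using K1 a by (simp add: K_def)
    fix \<mu> \<phi> assume \<mu>: "\<mu> \<in> C_per N" and \<phi>: "\<phi> \<in> C_per0 L N"
    have "cell_sum N (\<lambda>i j k. n i j k * \<mu> i j k) \<le>
        cell_sum N (\<lambda>i j k. (mean \<mu> + poincare_const * H1 \<mu>) * n i j k)"
    proof (rule cell_sum_mono)
      fix i j k
      have "\<mu> i j k \<le> mean \<mu> + poincare_const * H1 \<mu>" using poincare[OF \<mu>, of i j k] by linarith
      moreover have "0 \<le> n i j k" using n0(1) n0(2)[of i j k] by linarith
      ultimately show "n i j k * \<mu> i j k \<le> (mean \<mu> + poincare_const * H1 \<mu>) * n i j k"
        by (metis mult.commute mult_left_mono)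
    qed
    then have "cell_sum N (\<lambda>i j k. n i j k * \<mu> i j k) \<le> W * mean \<mu> + b * H1 \<mu>"
      unfolding cell_sum_mult by (simp add: W_def b_def algebra_simps)
    moreover have "a * (H1 \<mu>)\<^sup>2 \<le> \<tau> / 2 * dirichlet h N M \<mu> \<mu>"
      using mult_left_mono[OF dirichlet_ge[OF m(2), where h = h and N = N and u = \<mu>], of "\<tau> / 2"] \<tau>
      by (simp add: H1_power2 a_def mult_ac)
    moreover have "V * exp (mean \<mu>) \<le> cell_sum N (\<lambda>i j k. exp (\<mu> i j k - \<phi> i j k))"
      unfolding V_def by (rule cell_sum_exp_ge[OF \<mu> \<phi>])
    ultimately show "W * \<bar>mean \<mu>\<bar> + H1 \<mu> - K \<le>
       cell_sum N (\<lambda>i j k. exp (\<mu> i j k - \<phi> i j k)) - cell_sum N (\<lambda>i j k. n i j k * \<mu> i j k)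
       + \<tau> / 2 * dirichlet h N M \<mu> \<mu>"
      using K1(2)[of "mean \<mu>"] quadratic_ge_linear[OF a, of "H1 \<mu>" b] unfolding K_def by linarith
  qed
qed

end

section \<open>The scheme in potential variables\<close>

locale pnp_step = periodic_grid +
  fixes \<Delta>t D :: real and n p :: grid_fun
  assumes \<Delta>t: "\<Delta>t > 0" and D: "D > 0"
    and n: "n \<in> C_per N" "positive_on_cells N n"
    and p: "p \<in> C_per N" "positive_on_cells N p"
    and neutral: "(\<lambda>i j k. n i j k - p i j k) \<in> C_per0 L N"
begin

abbreviation Dp :: grid_fun where "Dp \<equiv> (\<lambda>i j k. D * p i j k)"

lemma Dp: "Dp \<in> C_per N" "positive_on_cells N Dp"
  using p D by (auto simp: positive_on_cells_def intro: C_per_map)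

lemma dirichlet_mobility_nonneg: "0 \<le> dirichlet h N n u u" "0 \<le> dirichlet h N Dp u u"
proof -
  have "0 \<le> dirichlet h N M u u" if "M \<in> C_per N" "positive_on_cells N M" for M
    using C_per_positive_bound[OF N_pos that]
    by (metis dirichlet_nonneg less_eq_real_def order_trans)
  then show "0 \<le> dirichlet h N n u u" "0 \<le> dirichlet h N Dp u u" using n Dp by simp_all
qed

text \<open>The \<open>- - \<phi>\<close> gives the second species the form covered by \<open>species_energy_coercive\<close>.\<close>

definition J :: "grid_fun \<times> grid_fun \<times> grid_fun \<Rightarrow> real" where
  "J = (\<lambda>(\<mu>, \<eta>, \<phi>).
     (cell_sum N (\<lambda>i j k. exp (\<mu> i j k - \<phi> i j k)) - cell_sum N (\<lambda>i j k. n i j k * \<mu> i j k)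
       + \<Delta>t / 2 * dirichlet h N n \<mu> \<mu>)
   + (cell_sum N (\<lambda>i j k. exp (\<eta> i j k - - \<phi> i j k)) - cell_sum N (\<lambda>i j k. p i j k * \<eta> i j k)
       + \<Delta>t / 2 * dirichlet h N Dp \<eta> \<eta>)
   + dirichlet h N one \<phi> \<phi> / 2)"

text \<open>The Euler-Lagrange system of \<open>J\<close>, which is the scheme multiplied by
  \<open>\<Delta>t\<close> with the densities written as exponentials.\<close>

definition critical :: "grid_fun \<Rightarrow> grid_fun \<Rightarrow> grid_fun \<Rightarrow> bool" where
  "critical \<mu> \<eta> \<phi> \<longleftrightarrow> \<mu> \<in> C_per N \<and> \<eta> \<in> C_per N \<and> \<phi> \<in> C_per0 L N \<and>
     (\<forall>i j k. exp (\<mu> i j k - \<phi> i j k) = n i j k + \<Delta>t * weighted_laplace h n \<mu> i j k \<and>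
       exp (\<eta> i j k + \<phi> i j k) = p i j k + \<Delta>t * weighted_laplace h Dp \<eta> i j k \<and>
       - laplace_h h \<phi> i j k = exp (\<mu> i j k - \<phi> i j k) - exp (\<eta> i j k + \<phi> i j k))"

lemma criticalD:
  assumes "critical \<mu> \<eta> \<phi>"
  shows "\<mu> \<in> C_per N" "\<eta> \<in> C_per N" "\<phi> \<in> C_per N" "\<phi> \<in> C_per0 L N"
    "exp (\<mu> i j k - \<phi> i j k) = n i j k + \<Delta>t * weighted_laplace h n \<mu> i j k"
    "exp (\<eta> i j k + \<phi> i j k) = p i j k + \<Delta>t * weighted_laplace h Dp \<eta> i j k"
    "- laplace_h h \<phi> i j k = exp (\<mu> i j k - \<phi> i j k) - exp (\<eta> i j k + \<phi> i j k)"
  using assms by (auto simp: critical_def C_per0_iff)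

section \<open>Existence of a minimiser of the energy\<close>

lemma exp_diff_per:
  "u \<in> C_per N \<Longrightarrow> v \<in> C_per N \<Longrightarrow> (\<lambda>i j k. exp (u i j k - v i j k)) \<in> C_per N"
  by (rule C_per_map2)

lemma exp_add_per:
  "u \<in> C_per N \<Longrightarrow> v \<in> C_per N \<Longrightarrow> (\<lambda>i j k. exp (u i j k + v i j k)) \<in> C_per N"
  by (rule C_per_map2)

lemma J_attains_min:
  obtains \<mu> \<eta> \<phi> where "\<mu> \<in> C_per N" "\<eta> \<in> C_per N" "\<phi> \<in> C_per0 L N"
    "\<And>u v w. u \<in> C_per N \<Longrightarrow> v \<in> C_per N \<Longrightarrow> w \<in> C_per0 L N \<Longrightarrow> J (\<mu>, \<eta>, \<phi>) \<le> J (u, v, w)"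
proof -
  obtain c1 K1 where c1: "c1 > 0" "K1 \<ge> 0"
    and J1: "\<And>\<mu> \<phi>. \<mu> \<in> C_per N \<Longrightarrow> \<phi> \<in> C_per0 L N \<Longrightarrow> c1 * \<bar>mean \<mu>\<bar> + H1 \<mu> - K1 \<le>
       cell_sum N (\<lambda>i j k. exp (\<mu> i j k - \<phi> i j k)) - cell_sum N (\<lambda>i j k. n i j k * \<mu> i j k)
       + \<Delta>t / 2 * dirichlet h N n \<mu> \<mu>"
    using species_energy_coercive[OF n n \<Delta>t] by blast
  obtain c2 K2 where c2: "c2 > 0" "K2 \<ge> 0"
    and J2: "\<And>\<eta> \<phi>. \<eta> \<in> C_per N \<Longrightarrow> \<phi> \<in> C_per0 L N \<Longrightarrow> c2 * \<bar>mean \<eta>\<bar> + H1 \<eta> - K2 \<le>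
       cell_sum N (\<lambda>i j k. exp (\<eta> i j k - \<phi> i j k)) - cell_sum N (\<lambda>i j k. p i j k * \<eta> i j k)
       + \<Delta>t / 2 * dirichlet h N Dp \<eta> \<eta>"
    using species_energy_coercive[OF p Dp \<Delta>t] by blast
  let ?z = "(\<lambda>i j k. 0) :: grid_fun"
  let ?S = "C_per N \<times> C_per N \<times> C_per0 L N"
  \<comment> \<open>The value at zero plus everything lost in the lower bounds: \<open>K1\<close>
    and \<open>K2\<close> for the species, and \<open>1 / 2\<close> from comparing
    \<open>(H1 \<phi>)\<^sup>2 / 2\<close> with \<open>H1 \<phi>\<close>. On the sublevel set,
    \<open>T\<close> bounds each of the nonnegative terms.\<close>
  define T where "T = J (?z, ?z, ?z) + K1 + K2 + 1 / 2"
  \<comment> \<open>Covers the means of \<mu> and \<eta> and the oscillations of all three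
    functions, so one box serves for each component; \<phi> has mean zero.\<close>
  define R where "R = T / c1 + T / c2 + poincare_const * T"
  define B where "B = {u :: grid_fun. \<forall>i j k. \<bar>u i j k\<bar> \<le> R}"
  have z: "(?z, ?z, ?z) \<in> ?S"
    by (simp add: C_per0_iff C_per_const cell_sum_const)
  have bound: "J x \<le> J (?z, ?z, ?z) \<Longrightarrow> x \<in> B \<times> B \<times> B" if "x \<in> ?S" for x
  proof -
    obtain \<mu> \<eta> \<phi> where x: "x = (\<mu>, \<eta>, \<phi>)" by (cases x)
    with that have per: "\<mu> \<in> C_per N" "\<eta> \<in> C_per N" "\<phi> \<in> C_per N" and \<phi>: "\<phi> \<in> C_per0 L N"
      by (auto simp: C_per0_iff)
    assume le: "J x \<le> J (?z, ?z, ?z)"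
    have "H1 \<phi> - 1 / 2 \<le> dirichlet h N one \<phi> \<phi> / 2"
      using quadratic_ge_linear[of "1 / 2" "H1 \<phi>" 0] by (simp add: H1_power2)
    with J1[OF per(1) \<phi>] J2[OF per(2) C_per0_minus[OF \<phi>]] le
    have le_T: "c1 * \<bar>mean \<mu>\<bar> + H1 \<mu> + c2 * \<bar>mean \<eta>\<bar> + H1 \<eta> + H1 \<phi> \<le> T"
      unfolding T_def x J_def by simp
    have nonneg: "c1 * \<bar>mean \<mu>\<bar> \<ge> 0" "c2 * \<bar>mean \<eta>\<bar> \<ge> 0" using c1 c2 by simp_all
    note nonneg = nonneg H1_nonneg[of \<mu>] H1_nonneg[of \<eta>] H1_nonneg[of \<phi>]
    have "c1 * \<bar>mean \<mu>\<bar> \<le> T" "c2 * \<bar>mean \<eta>\<bar> \<le> T" "H1 \<mu> \<le> T" "H1 \<eta> \<le> T" "H1 \<phi> \<le> T" "0 \<le> T"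
      using le_T nonneg by linarith+
    moreover from this have "T / c1 \<ge> 0" "T / c2 \<ge> 0" "\<bar>mean \<mu>\<bar> \<le> T / c1" "\<bar>mean \<eta>\<bar> \<le> T / c2"
      using c1 c2 by (simp_all add: field_simps)
    moreover have "mean \<phi> = 0" using \<phi> by (simp add: C_per0_iff mean_def)
    ultimately have *: "\<bar>mean u\<bar> + poincare_const * H1 u \<le> R" if "u \<in> {\<mu>, \<eta>, \<phi>}" for u
      unfolding R_def using that poincare_const_nonneg by (intro add_mono mult_left_mono) auto
    show "x \<in> B \<times> B \<times> B"
      unfolding x B_def using per
      by (auto intro!: order_trans[OF abs_le_mean_H1 *])
  qed
  have K: "compact (B \<times> B \<times> B)" unfolding B_def by (intro compact_Times compact_grid_box)
  have S: "closed ?S" by (intro closed_Times closed_C_per closed_C_per0)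
  have cont: "continuous_on UNIV J"
    unfolding J_def case_prod_beta divide_inverse
    by (intro continuous_intros continuous_on_grid_value[where f = fst]
        continuous_on_grid_value[where f = "\<lambda>x. fst (snd x)"]
        continuous_on_grid_value[where f = "\<lambda>x. snd (snd x)"])
  obtain x where "x \<in> ?S" "\<And>y. y \<in> ?S \<Longrightarrow> J x \<le> J y"
    using attains_inf_if_sublevel_compact[OF K S cont z bound] by blast
  then show ?thesis by (cases x) (auto intro: that)
qed

section \<open>First variation and Euler-Lagrange equations\<close>

lemma J_has_derivative:
  "((\<lambda>t. J (\<lambda>i j k. \<mu> i j k + t * u i j k, \<lambda>i j k. \<eta> i j k + t * v i j k, \<lambda>i j k. \<phi> i j k + t * w i j k))
     has_real_derivative
     (cell_sum N (\<lambda>i j k. exp (\<mu> i j k - \<phi> i j k) * (u i j k - w i j k))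
       - cell_sum N (\<lambda>i j k. n i j k * u i j k) + \<Delta>t * dirichlet h N n \<mu> u)
   + (cell_sum N (\<lambda>i j k. exp (\<eta> i j k + \<phi> i j k) * (v i j k + w i j k))
       - cell_sum N (\<lambda>i j k. p i j k * v i j k) + \<Delta>t * dirichlet h N Dp \<eta> v)
   + dirichlet h N one \<phi> w) (at 0)"
proof -
  have q: "((\<lambda>t. a + 2 * t * b + t\<^sup>2 * c) has_real_derivative 2 * b) (at 0)" for a b c :: real
    by (auto intro!: derivative_eq_intros)
  have e1: "((\<lambda>t. cell_sum N (\<lambda>i j k. exp (\<mu> i j k + t * u i j k - (\<phi> i j k + t * w i j k))))
      has_real_derivative cell_sum N (\<lambda>i j k. exp (\<mu> i j k - \<phi> i j k) * (u i j k - w i j k))) (at 0)"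
    by (rule cell_sum_has_derivative) (auto intro!: derivative_eq_intros)
  have e2: "((\<lambda>t. cell_sum N (\<lambda>i j k. exp (\<eta> i j k + t * v i j k - - (\<phi> i j k + t * w i j k))))
      has_real_derivative cell_sum N (\<lambda>i j k. exp (\<eta> i j k + \<phi> i j k) * (v i j k + w i j k))) (at 0)"
    by (rule cell_sum_has_derivative) (auto intro!: derivative_eq_intros)
  have l1: "((\<lambda>t. cell_sum N (\<lambda>i j k. n i j k * (\<mu> i j k + t * u i j k)))
      has_real_derivative cell_sum N (\<lambda>i j k. n i j k * u i j k)) (at 0)"
    by (rule cell_sum_has_derivative) (auto intro!: derivative_eq_intros)
  have l2: "((\<lambda>t. cell_sum N (\<lambda>i j k. p i j k * (\<eta> i j k + t * v i j k)))
      has_real_derivative cell_sum N (\<lambda>i j k. p i j k * v i j k)) (at 0)"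
    by (rule cell_sum_has_derivative) (auto intro!: derivative_eq_intros)
  show ?thesis
    unfolding J_def prod.case dirichlet_quadratic
    by (rule DERIV_cong[OF DERIV_add[OF DERIV_add[OF DERIV_add[OF DERIV_diff[OF e1 l1] DERIV_cmult[OF q]]
          DERIV_add[OF DERIV_diff[OF e2 l2] DERIV_cmult[OF q]]] DERIV_cdivide[OF q]]]) simp
qed

text \<open>The residual of each Euler--Lagrange equation is itself an admissible test direction, so the sum
  of its squares vanishes. For \<open>\<phi>\<close> the residual has mean zero only because the first two equations
  conserve mass and \<open>n - p\<close> has mean zero.\<close>

lemma critical_exists: obtains \<mu> \<eta> \<phi> where "critical \<mu> \<eta> \<phi>"
proof -
  obtain \<mu> \<eta> \<phi> where per: "\<mu> \<in> C_per N" "\<eta> \<in> C_per N" "\<phi> \<in> C_per0 L N"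
    and min: "\<And>u v w. u \<in> C_per N \<Longrightarrow> v \<in> C_per N \<Longrightarrow> w \<in> C_per0 L N \<Longrightarrow> J (\<mu>, \<eta>, \<phi>) \<le> J (u, v, w)"
    using J_attains_min by blast
  define a where "a = (\<lambda>i j k. exp (\<mu> i j k - \<phi> i j k))"
  define b where "b = (\<lambda>i j k. exp (\<eta> i j k + \<phi> i j k))"
  have ab: "a \<in> C_per N" "b \<in> C_per N"
    unfolding a_def b_def by (intro exp_diff_per exp_add_per per C_per0_per)+
  have EL: "(cell_sum N (\<lambda>i j k. a i j k * (u i j k - w i j k))
       - cell_sum N (\<lambda>i j k. n i j k * u i j k) + \<Delta>t * dirichlet h N n \<mu> u)
   + (cell_sum N (\<lambda>i j k. b i j k * (v i j k + w i j k))
       - cell_sum N (\<lambda>i j k. p i j k * v i j k) + \<Delta>t * dirichlet h N Dp \<eta> v)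
   + dirichlet h N one \<phi> w = 0" (is "?E = 0")
    if "u \<in> C_per N" "v \<in> C_per N" "w \<in> C_per0 L N" for u v w
  proof (rule DERIV_global_min)
    show "((\<lambda>t. J (\<lambda>i j k. \<mu> i j k + t * u i j k, \<lambda>i j k. \<eta> i j k + t * v i j k, \<lambda>i j k. \<phi> i j k + t * w i j k))
      has_real_derivative ?E) (at 0)"
      unfolding a_def b_def by (rule J_has_derivative)
    show "J (\<lambda>i j k. \<mu> i j k + 0 * u i j k, \<lambda>i j k. \<eta> i j k + 0 * v i j k, \<lambda>i j k. \<phi> i j k + 0 * w i j k)
      \<le> J (\<lambda>i j k. \<mu> i j k + t * u i j k, \<lambda>i j k. \<eta> i j k + t * v i j k, \<lambda>i j k. \<phi> i j k + t * w i j k)"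
      for t
      using min[OF C_per_add_mult[OF per(1) that(1)] C_per_add_mult[OF per(2) that(2)]
          C_per0_add_mult[OF per(3) that(3)], of t t t] by simp
  qed
  let ?z = "(\<lambda>i j k. 0) :: grid_fun"
  have z: "?z \<in> C_per N" "?z \<in> C_per0 L N"
    by (simp_all add: C_per0_iff C_per_const cell_sum_const)
  have dz: "dirichlet h N M u ?z = 0" for M u
    by (simp add: dirichlet_def cell_sum_const Dx_def Dy_def Dz_def)

  \<comment> \<open>The argument common to both species: the weak equation is tested with its own
    residual \<open>r\<close>. It is applied below to \<open>EL\<close> with the other two
    directions set to zero.\<close>
  have density: "a' i j k = s i j k + \<Delta>t * weighted_laplace h M \<nu> i j k"
    if "a' \<in> C_per N" "s \<in> C_per N" "M \<in> C_per N" "\<nu> \<in> C_per N"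
      and E: "\<And>u. u \<in> C_per N \<Longrightarrow> cell_sum N (\<lambda>i j k. a' i j k * u i j k)
         - cell_sum N (\<lambda>i j k. s i j k * u i j k) + \<Delta>t * dirichlet h N M \<nu> u = 0"
    for a' s M \<nu> i j k
  proof -
    define r where "r = (\<lambda>i j k. a' i j k - (s i j k + \<Delta>t * weighted_laplace h M \<nu> i j k))"
    have r: "r \<in> C_per N" unfolding r_def
      by (intro C_per_map2[where g = "(-)"] C_per_add_mult weighted_laplace_per that)
    have "cell_sum N (\<lambda>i j k. (r i j k)\<^sup>2) = cell_sum N (\<lambda>i j k. a' i j k * r i j k
        - s i j k * r i j k - \<Delta>t * (weighted_laplace h M \<nu> i j k * r i j k))"
      by (rule arg_cong[where f = "cell_sum N"], intro ext)
        (simp add: r_def power2_eq_square algebra_simps)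
    also have "\<dots> = 0"
      using E[OF r] weighted_laplace_by_parts[OF that(3,4) r, of h]
      by (simp add: cell_sum_diff cell_sum_mult)
    finally have "(r i j k)\<^sup>2 = 0"
      by (intro cell_sum_nonneg_eq_0[OF N_pos] C_per_map[OF r, of power2]) simp_all
    then show ?thesis by (simp add: r_def)
  qed
  have 1: "a i j k = n i j k + \<Delta>t * weighted_laplace h n \<mu> i j k" for i j k
    using EL[OF _ z] by (intro density ab n per) (simp add: dz cell_sum_const)
  have 2: "b i j k = p i j k + \<Delta>t * weighted_laplace h Dp \<eta> i j k" for i j k
    using EL[OF z(1) _ z(2)] by (intro density ab p Dp per) (simp add: dz cell_sum_const)

  define r where "r = (\<lambda>i j k. (a i j k - b i j k) + 1 * laplace_h h \<phi> i j k)"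
  have "a = (\<lambda>i j k. n i j k + \<Delta>t * weighted_laplace h n \<mu> i j k)"
    "b = (\<lambda>i j k. p i j k + \<Delta>t * weighted_laplace h Dp \<eta> i j k)"
    using 1 2 by (simp_all add: fun_eq_iff)
  then have mass: "cell_sum N a = cell_sum N n" "cell_sum N b = cell_sum N p"
    using cell_sum_weighted_laplace[OF n(1) per(1), of h] cell_sum_weighted_laplace[OF Dp(1) per(2), of h]
    by (simp_all only: cell_sum_add cell_sum_mult mult_zero_right add_0_right)
  have "(\<lambda>i j k. a i j k - b i j k) \<in> C_per0 L N"
    using neutral ab by (simp add: C_per0_iff cell_sum_diff mass C_per_map2)
  moreover have "laplace_h h \<phi> \<in> C_per0 L N"
    unfolding laplace_h_conv_weighted[abs_def] using per(3)
    by (simp add: C_per0_iff weighted_laplace_per C_per_const cell_sum_weighted_laplace)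
  ultimately have r: "r \<in> C_per0 L N" unfolding r_def by (rule C_per0_add_mult)
  \<comment> \<open>By parts, the last sum is minus the Dirichlet form of \<phi> and
    \<open>r\<close>; the total is therefore the negative of \<open>EL\<close> in the direction
    \<open>(0, 0, r)\<close>.\<close>
  have "cell_sum N (\<lambda>i j k. (r i j k)\<^sup>2) = cell_sum N (\<lambda>i j k. a i j k * r i j k
      - b i j k * r i j k + weighted_laplace h one \<phi> i j k * r i j k)"
    by (rule arg_cong[where f = "cell_sum N"], intro ext)
      (simp add: r_def laplace_h_conv_weighted power2_eq_square algebra_simps)
  also have "\<dots> = 0"
    using EL[OF z(1) z(1) r] weighted_laplace_by_parts[OF C_per_const[of 1] C_per0_per[OF per(3)] C_per0_per[OF r], of h]
    by (simp add: cell_sum_diff cell_sum_add cell_sum_minus dz cell_sum_const)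
  finally have "(r i j k)\<^sup>2 = 0" for i j k
    by (intro cell_sum_nonneg_eq_0[OF N_pos] C_per_map[OF C_per0_per[OF r], of power2]) simp_all
  then have 3: "- laplace_h h \<phi> i j k = a i j k - b i j k" for i j k
    by (simp add: r_def minus_equation_iff add_eq_0_iff)
  show ?thesis
    using per 1 2 3 unfolding a_def b_def by (intro that[of \<mu> \<eta> \<phi>]) (simp add: critical_def)
qed

text \<open>Testing the difference of the two systems with the differences of \<open>\<mu>\<close>, \<open>\<eta>\<close>, \<open>\<phi>\<close> leaves only
  terms of one sign, by monotonicity of \<open>exp\<close>.\<close>

lemma critical_unique:
  assumes "critical \<mu> \<eta> \<phi>" "critical \<mu>' \<eta>' \<phi>'"
  shows "\<mu> i j k - \<phi> i j k = \<mu>' i j k - \<phi>' i j k" "\<eta> i j k + \<phi> i j k = \<eta>' i j k + \<phi>' i j k"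
proof -
  note c = criticalD[OF assms(1)] criticalD[OF assms(2)]
  define a where "a = (\<lambda>i j k. exp (\<mu> i j k - \<phi> i j k) - exp (\<mu>' i j k - \<phi>' i j k))"
  define b where "b = (\<lambda>i j k. exp (\<eta> i j k + \<phi> i j k) - exp (\<eta>' i j k + \<phi>' i j k))"
  define u where "u = (\<lambda>i j k. \<mu> i j k + (-1) * \<mu>' i j k)"
  define v where "v = (\<lambda>i j k. \<eta> i j k + (-1) * \<eta>' i j k)"
  define w where "w = (\<lambda>i j k. \<phi> i j k + (-1) * \<phi>' i j k)"
  have per: "u \<in> C_per N" "v \<in> C_per N" "w \<in> C_per N"
    unfolding u_def v_def w_def by (intro C_per_add_mult c)+
  have ab: "a \<in> C_per N" "b \<in> C_per N"
    unfolding a_def b_def by (intro C_per_map2[where g = "(-)"] exp_diff_per exp_add_per c)+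
  have "a i j k = \<Delta>t * weighted_laplace h n u i j k" "b i j k = \<Delta>t * weighted_laplace h Dp v i j k"
    "- weighted_laplace h one w i j k = a i j k - b i j k" for i j k
    using c(5-7,12-14)[of i j k]
    unfolding u_def v_def w_def weighted_laplace_add_mult a_def b_def laplace_h_conv_weighted
    by (simp_all add: algebra_simps)
  then have eqs: "a = (\<lambda>i j k. \<Delta>t * weighted_laplace h n u i j k)"
    "b = (\<lambda>i j k. \<Delta>t * weighted_laplace h Dp v i j k)"
    "(\<lambda>i j k. a i j k - b i j k) = (\<lambda>i j k. - weighted_laplace h one w i j k)"
    by (simp_all add: fun_eq_iff)
  have "cell_sum N (\<lambda>i j k. a i j k * u i j k) = - \<Delta>t * dirichlet h N n u u"
    using weighted_laplace_by_parts[OF n(1) per(1) per(1), of h]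
    by (simp add: eqs(1) mult.assoc cell_sum_mult)
  moreover have "cell_sum N (\<lambda>i j k. b i j k * v i j k) = - \<Delta>t * dirichlet h N Dp v v"
    using weighted_laplace_by_parts[OF Dp(1) per(2) per(2), of h]
    by (simp add: eqs(2) mult.assoc cell_sum_mult)
  moreover have "cell_sum N (\<lambda>i j k. (a i j k - b i j k) * w i j k) = dirichlet h N one w w"
    using weighted_laplace_by_parts[OF C_per_const[of 1] per(3) per(3), of h]
    by (simp add: fun_cong[OF fun_cong[OF fun_cong[OF eqs(3)]]] cell_sum_minus)
  moreover have "0 \<le> \<Delta>t * dirichlet h N n u u" "0 \<le> \<Delta>t * dirichlet h N Dp v v" "0 \<le> dirichlet h N one w w"
    using \<Delta>t dirichlet_mobility_nonneg by (auto intro: dirichlet_nonneg)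
  \<comment> \<open>Regrouping the three tested equations: the sum in \<open>le\<close> equals minus
    the three Dirichlet energies, the two mobility ones with factor
    \<open>\<Delta>t\<close>.\<close>
  moreover have "cell_sum N (\<lambda>i j k. a i j k * (u i j k - w i j k)) =
      cell_sum N (\<lambda>i j k. a i j k * u i j k) - cell_sum N (\<lambda>i j k. a i j k * w i j k)"
    "cell_sum N (\<lambda>i j k. b i j k * (v i j k + w i j k)) =
      cell_sum N (\<lambda>i j k. b i j k * v i j k) + cell_sum N (\<lambda>i j k. b i j k * w i j k)"
    "cell_sum N (\<lambda>i j k. (a i j k - b i j k) * w i j k) =
      cell_sum N (\<lambda>i j k. a i j k * w i j k) - cell_sum N (\<lambda>i j k. b i j k * w i j k)"
    by (simp_all add: cell_sum_add[symmetric] cell_sum_diff[symmetric] algebra_simps)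
  ultimately have le: "cell_sum N (\<lambda>i j k. a i j k * (u i j k - w i j k))
      + cell_sum N (\<lambda>i j k. b i j k * (v i j k + w i j k)) \<le> 0"
    by linarith
  \<comment> \<open>Here \<open>u - w\<close> and \<open>v + w\<close> are exactly the differences
    of the exponents occurring in \<open>a\<close> and \<open>b\<close>.\<close>
  have nonneg: "0 \<le> a i j k * (u i j k - w i j k)" "0 \<le> b i j k * (v i j k + w i j k)" for i j k
    using exp_diff_mult_nonneg[of "\<mu> i j k - \<phi> i j k" "\<mu>' i j k - \<phi>' i j k"]
      exp_diff_mult_nonneg[of "\<eta> i j k + \<phi> i j k" "\<eta>' i j k + \<phi>' i j k"]
    by (simp_all add: a_def b_def u_def v_def w_def algebra_simps)
  have le0: "cell_sum N (\<lambda>i j k. a i j k * (u i j k - w i j k)) \<le> 0"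
    "cell_sum N (\<lambda>i j k. b i j k * (v i j k + w i j k)) \<le> 0"
    using le cell_sum_nonneg[of "\<lambda>i j k. a i j k * (u i j k - w i j k)" N, OF nonneg(1)]
      cell_sum_nonneg[of "\<lambda>i j k. b i j k * (v i j k + w i j k)" N, OF nonneg(2)] by linarith+
  have "(\<lambda>i j k. a i j k * (u i j k - w i j k)) \<in> C_per N" "(\<lambda>i j k. b i j k * (v i j k + w i j k)) \<in> C_per N"
    using ab per by (simp_all add: C_per_def)
  then have "a i j k * (u i j k - w i j k) = 0" "b i j k * (v i j k + w i j k) = 0"
    using cell_sum_nonneg_eq_0[OF N_pos _ nonneg(1) le0(1)]
      cell_sum_nonneg_eq_0[OF N_pos _ nonneg(2) le0(2)] by blast+
  \<comment> \<open>Whichever factor vanishes, the exponents agree, since \<open>exp\<close> is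
    injective.\<close>
  then show "\<mu> i j k - \<phi> i j k = \<mu>' i j k - \<phi>' i j k" "\<eta> i j k + \<phi> i j k = \<eta>' i j k + \<phi>' i j k"
    by (auto simp: a_def b_def u_def v_def w_def)
qed

section \<open>From potentials back to densities\<close>

definition step :: "grid_fun \<Rightarrow> grid_fun \<Rightarrow> bool" where
  "step n' p' \<longleftrightarrow> n' \<in> C_per N \<and> p' \<in> C_per N \<and>
     positive_on_cells N n' \<and> positive_on_cells N p' \<and>
     (\<lambda>i j k. n' i j k - p' i j k) \<in> C_per0 L N \<and> solves_scheme \<Delta>t D L N n p n' p'"

lemma solves_scheme_iff:
  "solves_scheme \<Delta>t D L N n p n' p' \<longleftrightarrow>
    (\<forall>i j k. n' i j k = n i j k + \<Delta>t * weighted_laplace h n (potential L N n' p') i j k \<and>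
       p' i j k = p i j k + \<Delta>t * weighted_laplace h Dp (potential L N p' n') i j k)"
  using \<Delta>t by (simp add: solves_scheme_def Let_def weighted_laplace_def field_simps)

text \<open>The difference of the densities is minus a discrete Laplacian, hence of mean zero, and
  \<phi> is its inverse Laplacian. Therefore the chemical potentials of the two densities are \<mu>
  and \<eta>.\<close>

lemma critical_imp_step:
  assumes "critical \<mu> \<eta> \<phi>"
  shows "step (\<lambda>i j k. exp (\<mu> i j k - \<phi> i j k)) (\<lambda>i j k. exp (\<eta> i j k + \<phi> i j k))"
proof -
  note c = criticalD[OF assms]
  define a where "a = (\<lambda>i j k. exp (\<mu> i j k - \<phi> i j k))"
  define b where "b = (\<lambda>i j k. exp (\<eta> i j k + \<phi> i j k))"
  have ab: "a \<in> C_per N" "b \<in> C_per N"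
    unfolding a_def b_def by (intro exp_diff_per exp_add_per c)+
  have diff: "(\<lambda>i j k. a i j k - b i j k) = (\<lambda>i j k. - weighted_laplace h one \<phi> i j k)"
    unfolding a_def b_def laplace_h_conv_weighted[symmetric] c(7) ..
  have "cell_sum N (\<lambda>i j k. a i j k - b i j k) = 0"
    unfolding diff cell_sum_minus by (simp add: cell_sum_weighted_laplace C_per_const c)
  then have ab0: "(\<lambda>i j k. a i j k - b i j k) \<in> C_per0 L N"
    using ab by (simp add: C_per0_iff C_per_map2)
  have inv: "inv_neg_laplace_h L N (\<lambda>i j k. a i j k - b i j k) = \<phi>"
    unfolding a_def b_def by (intro inv_neg_laplace_h_eqI c)
  have "potential L N a b = \<mu>"
    unfolding potential_def inv by (simp add: a_def)
  moreover have "potential L N b a = \<eta>"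
    unfolding potential_def using inv_neg_laplace_h_minus[OF ab0] by (simp add: inv) (simp add: b_def)
  ultimately have "solves_scheme \<Delta>t D L N n p a b"
    unfolding solves_scheme_iff using c(5,6) by (simp add: a_def b_def)
  with ab ab0 show ?thesis
    unfolding step_def a_def b_def by (simp add: positive_on_cells_def)
qed

text \<open>The converse passage, which carries uniqueness over from critical triples to solutions
  of the scheme.\<close>

lemma step_imp_critical:
  assumes "step n' p'"
  obtains \<mu> \<eta> \<phi> where "critical \<mu> \<eta> \<phi>"
    "n' = (\<lambda>i j k. exp (\<mu> i j k - \<phi> i j k))" "p' = (\<lambda>i j k. exp (\<eta> i j k + \<phi> i j k))"
proof -
  note s = assms[unfolded step_def]
  define \<phi> where "\<phi> = inv_neg_laplace_h L N (\<lambda>i j k. n' i j k - p' i j k)"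
  have d0: "(\<lambda>i j k. n' i j k - p' i j k) \<in> C_per0 L N" using s by blast
  have \<phi>: "\<phi> \<in> C_per0 L N" "\<And>i j k. - laplace_h h \<phi> i j k = n' i j k - p' i j k"
    unfolding \<phi>_def using inv_neg_laplace_h_solves[OF d0] by simp_all
  \<comment> \<open>Positivity on one period extends to all indices, so \<open>exp\<close> undoes
    \<open>ln\<close> everywhere.\<close>
  have pos: "n' i j k > 0" "p' i j k > 0" for i j k
    using s C_per_positive_bound[OF N_pos] by (metis less_le_trans)+
  have \<mu>: "potential L N n' p' = (\<lambda>i j k. ln (n' i j k) + \<phi> i j k)"
    by (simp add: potential_def \<phi>_def)
  have \<eta>: "potential L N p' n' = (\<lambda>i j k. ln (p' i j k) - \<phi> i j k)"
    using inv_neg_laplace_h_minus[OF d0] by (simp add: potential_def \<phi>_def)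
  have n': "exp (potential L N n' p' i j k - \<phi> i j k) = n' i j k"
    and p': "exp (potential L N p' n' i j k + \<phi> i j k) = p' i j k" for i j k
    using pos by (simp_all add: \<mu> \<eta>)
  have "solves_scheme \<Delta>t D L N n p n' p'" using s by blast
  note scheme = this[unfolded solves_scheme_iff, rule_format]
  have "n' \<in> C_per N" "p' \<in> C_per N" using s by simp_all
  then have "potential L N n' p' \<in> C_per N" "potential L N p' n' \<in> C_per N"
    unfolding \<mu> \<eta> using C_per0_per[OF \<phi>(1)] by (simp_all add: C_per_def)
  then have "critical (potential L N n' p') (potential L N p' n') \<phi>"
    unfolding critical_def n' p' using \<phi> scheme by blast
  moreover have "n' = (\<lambda>i j k. exp (potential L N n' p' i j k - \<phi> i j k))"
    "p' = (\<lambda>i j k. exp (potential L N p' n' i j k + \<phi> i j k))"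
    unfolding n' p' by (rule refl)+
  ultimately show ?thesis by (rule that)
qed

lemma step_exists_unique: "\<exists>!np. case np of (n', p') \<Rightarrow> step n' p'"
proof -
  obtain \<mu> \<eta> \<phi> where c: "critical \<mu> \<eta> \<phi>" by (rule critical_exists)
  define a where "a = (\<lambda>i j k. exp (\<mu> i j k - \<phi> i j k))"
  define b where "b = (\<lambda>i j k. exp (\<eta> i j k + \<phi> i j k))"
  have ex: "step a b" unfolding a_def b_def by (rule critical_imp_step[OF c])
  have unique: "n' = a \<and> p' = b" if step: "step n' p'" for n' p'
  proof -
    obtain \<mu>' \<eta>' \<phi>' where "critical \<mu>' \<eta>' \<phi>'"
      "n' = (\<lambda>i j k. exp (\<mu>' i j k - \<phi>' i j k))" "p' = (\<lambda>i j k. exp (\<eta>' i j k + \<phi>' i j k))"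
      using step by (rule step_imp_critical)
    with critical_unique[OF this(1) c] show ?thesis by (simp add: a_def b_def)
  qed
  show ?thesis
  proof (rule ex1I[of _ "(a, b)"])
    show "case (a, b) of (n', p') \<Rightarrow> step n' p'" using ex by simp
    show "np = (a, b)" if "case np of (n', p') \<Rightarrow> step n' p'" for np
      using unique[of "fst np" "snd np"] that by (simp add: case_prod_beta prod_eq_iff)
  qed
qed

end

theorem theorem3p1:
  fixes \<Delta>t D L :: real and N :: nat and n p :: grid_fun
  assumes "\<Delta>t > 0" and "D > 0" and "L > 0" and "N \<ge> 1"
    and "n \<in> C_per N" and "p \<in> C_per N"
    and "positive_on_cells N n" and "positive_on_cells N p"
    and "(\<lambda>i j k. n i j k - p i j k) \<in> C_per0 L N"
  shows "\<exists>!np. case np of (n', p') \<Rightarrow>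
           n' \<in> C_per N \<and> p' \<in> C_per N \<and>
           positive_on_cells N n' \<and> positive_on_cells N p' \<and>
           (\<lambda>i j k. n' i j k - p' i j k) \<in> C_per0 L N \<and>
           solves_scheme \<Delta>t D L N n p n' p'"
proof -
  interpret pnp_step L N \<Delta>t D n p
    by unfold_locales (use assms in auto)
  show ?thesis using step_exists_unique unfolding step_def .
qed

end
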